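(* Let $a,b\in\mathbb{C}$. (a) If $0<|ab|\le \frac{64}{6}$, then all eigenvalues of the operator $A(a,b)$ are simple. (b) If $0<|ab|\le \frac{16}{9}$, then all eigenvalues of the operator $P(a,b)$ are simple.
   Context: For $a,b\in\mathbb{C}$, the operators $P(a,b)$ and $A(a,b)$ act in $L_2[0,\pi]$ and are generated by the differential expression $-y''(x)+q(x)y(x)$ with $q(x)=ae^{-i2x}+be^{i2x}$ together with, respectively, the periodic conditions $y(\pi)=y(0),\ y'(\pi)=y'(0)$ and the antiperiodic conditions $y(\pi)=-y(0),\ y'(\pi)=-y'(0)$. The multiplicity of an eigenvalue is its algebraic multiplicity (the number of linearly independent root functions, i.e. eigenfunctions and associated functions), and an eigenvalue is simple if its algebraic multiplicity is $1$. *)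

theory Defs
  imports "HOL-Analysis.Analysis"
begin

section \<open>The complex vector space L2[0, pi]\<close>

definition square_integrable :: "(real \<Rightarrow> complex) \<Rightarrow> bool" where
  "square_integrable f \<longleftrightarrow>
     f \<in> borel_measurable (lebesgue_on {0..pi}) \<and>
     integrable (lebesgue_on {0..pi}) (\<lambda>x. (cmod (f x))\<^sup>2)"

definition l2_eq :: "(real \<Rightarrow> complex) \<Rightarrow> (real \<Rightarrow> complex) \<Rightarrow> bool" where
  "l2_eq f g \<longleftrightarrow> square_integrable f \<and> square_integrable g \<and>
     (AE x in lebesgue_on {0..pi}. f x = g x)"

lemma square_integrable_zero: "square_integrable (\<lambda>x. 0)"
  by (simp add: square_integrable_def)

lemma square_integrable_add:
  assumes "square_integrable f" "square_integrable g"
  shows "square_integrable (\<lambda>x. f x + g x)"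
proof -
  have m: "f \<in> borel_measurable (lebesgue_on {0..pi})"
          "g \<in> borel_measurable (lebesgue_on {0..pi})"
    using assms by (auto simp: square_integrable_def)
  have bound: "(cmod (f x + g x))\<^sup>2 \<le> 2 * (cmod (f x))\<^sup>2 + 2 * (cmod (g x))\<^sup>2" for x
  proof -
    have "(cmod (f x + g x))\<^sup>2 \<le> (cmod (f x) + cmod (g x))\<^sup>2"
      by (intro power_mono norm_triangle_ineq) auto
    also have "\<dots> \<le> 2 * (cmod (f x))\<^sup>2 + 2 * (cmod (g x))\<^sup>2"
      using zero_le_power2[of "cmod (f x) - cmod (g x)"]
      by (simp add: power2_sum power2_diff)
    finally show ?thesis .
  qed
  have "integrable (lebesgue_on {0..pi}) (\<lambda>x. (cmod (f x + g x))\<^sup>2)"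
  proof (rule Bochner_Integration.integrable_bound)
    show "integrable (lebesgue_on {0..pi}) (\<lambda>x. 2 * (cmod (f x))\<^sup>2 + 2 * (cmod (g x))\<^sup>2)"
      using assms by (auto simp: square_integrable_def)
    show "(\<lambda>x. (cmod (f x + g x))\<^sup>2) \<in> borel_measurable (lebesgue_on {0..pi})"
      using m by measurable
    show "AE x in lebesgue_on {0..pi}. norm ((cmod (f x + g x))\<^sup>2)
            \<le> norm (2 * (cmod (f x))\<^sup>2 + 2 * (cmod (g x))\<^sup>2)"
      using bound by simp
  qed
  then show ?thesis
    using m by (auto simp: square_integrable_def)
qed

lemma square_integrable_scale:
  assumes "square_integrable f"
  shows "square_integrable (\<lambda>x. c * f x)"
  using assms by (auto simp: square_integrable_def norm_mult power_mult_distrib)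

quotient_type l2 = "real \<Rightarrow> complex" / partial: l2_eq
proof (rule part_equivpI)
  show "\<exists>f. l2_eq f f"
    using square_integrable_zero by (auto simp: l2_eq_def)
  show "symp l2_eq"
    by (auto simp: symp_def l2_eq_def elim!: AE_mp)
  show "transp l2_eq"
    by (auto simp: transp_def l2_eq_def elim!: AE_mp)
qed

lift_definition scale_l2 :: "complex \<Rightarrow> l2 \<Rightarrow> l2" is "\<lambda>c f x. c * f x"
  by (auto simp: l2_eq_def square_integrable_scale elim!: AE_mp)

instantiation l2 :: ab_group_add
begin

lift_definition zero_l2 :: l2 is "\<lambda>x. 0"
  by (simp add: l2_eq_def square_integrable_zero)

lift_definition plus_l2 :: "l2 \<Rightarrow> l2 \<Rightarrow> l2" is "\<lambda>f g x. f x + g x"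
  by (auto simp: l2_eq_def square_integrable_add elim!: AE_mp)

definition uminus_l2 :: "l2 \<Rightarrow> l2" where "- u = scale_l2 (-1) u"

definition minus_l2 :: "l2 \<Rightarrow> l2 \<Rightarrow> l2" where "u - v = u + - (v :: l2)"

instance
proof
  fix u v w :: l2
  show "u + v + w = u + (v + w)"
    by transfer (auto simp: l2_eq_def add.assoc intro!: square_integrable_add)
  show "u + v = v + u"
    by transfer (auto simp: l2_eq_def add.commute intro!: square_integrable_add)
  show "0 + u = u"
    by transfer (auto simp: l2_eq_def)
  show "- u + u = 0"
    unfolding uminus_l2_def
    by transfer (auto simp: l2_eq_def square_integrable_zero)
  show "u - v = u + - v"
    by (fact minus_l2_def)
qed

end

interpretation l2: vector_space scale_l2
proof
  fix c d :: complex and u v :: l2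
  show "scale_l2 c (u + v) = scale_l2 c u + scale_l2 c v"
    by transfer (auto simp: l2_eq_def distrib_left
                      intro!: square_integrable_add square_integrable_scale)
  show "scale_l2 (c + d) u = scale_l2 c u + scale_l2 d u"
    by transfer (auto simp: l2_eq_def distrib_right[symmetric]
                      intro!: square_integrable_add square_integrable_scale)
  show "scale_l2 c (scale_l2 d u) = scale_l2 (c * d) u"
    by transfer (auto simp: l2_eq_def mult.assoc intro!: square_integrable_scale)
  show "scale_l2 1 u = u"
    by transfer (auto simp: l2_eq_def)
qed


section \<open>Eigenvalues and algebraic multiplicity of unbounded operators\<close>

text \<open>
  An operator in L2 is represented by its graph, a set of pairs (u, Tu) with u in the domain.
  Iterated relational composition of the graph is then the graph of the power of the operator
  on its natural domain.
\<close>

definition eigenvalue :: "(l2 \<times> l2) set \<Rightarrow> complex \<Rightarrow> bool" where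
  "eigenvalue T \<mu> \<longleftrightarrow> (\<exists>u. u \<noteq> 0 \<and> (u, scale_l2 \<mu> u) \<in> T)"

definition shifted :: "(l2 \<times> l2) set \<Rightarrow> complex \<Rightarrow> (l2 \<times> l2) set" where
  "shifted T \<mu> = {(u, v - scale_l2 \<mu> u) | u v. (u, v) \<in> T}"

text \<open>The eigenfunctions and associated functions at \<open>\<mu>\<close>, together with 0.\<close>

definition root_space :: "(l2 \<times> l2) set \<Rightarrow> complex \<Rightarrow> l2 set" where
  "root_space T \<mu> = {u. \<exists>n. (u, 0) \<in> shifted T \<mu> ^^ n}"

text \<open>
  \<open>l2.dim\<close> is 0 for an infinite-dimensional space, so for an eigenvalue the value 1 says
  exactly that the root space is one-dimensional.
\<close>

definition algebraic_multiplicity :: "(l2 \<times> l2) set \<Rightarrow> complex \<Rightarrow> nat" where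
  "algebraic_multiplicity T \<mu> = l2.dim (root_space T \<mu>)"

definition simple_eigenvalue :: "(l2 \<times> l2) set \<Rightarrow> complex \<Rightarrow> bool" where
  "simple_eigenvalue T \<mu> \<longleftrightarrow> eigenvalue T \<mu> \<and> algebraic_multiplicity T \<mu> = 1"


section \<open>The operators\<close>

text \<open>
  \<open>sobolev2 y y1 y2\<close>: the function y is in the Sobolev space of order 2 on [0, pi], with
  derivative y1 (everywhere, one-sided at the end points) and second derivative y2 (almost
  everywhere). Absolute continuity of y1 with derivative y2 is expressed by y1 being an
  indefinite integral of y2; only the class of y2 in L2 is determined by y.
\<close>

definition sobolev2 ::
  "(real \<Rightarrow> complex) \<Rightarrow> (real \<Rightarrow> complex) \<Rightarrow> (real \<Rightarrow> complex) \<Rightarrow> bool" where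
  "sobolev2 y y1 y2 \<longleftrightarrow>
     (\<forall>x\<in>{0..pi}. (y has_vector_derivative y1 x) (at x within {0..pi})) \<and>
     square_integrable y2 \<and>
     (\<forall>x\<in>{0..pi}. (y2 has_integral (y1 x - y1 0)) {0..x})"

definition potential :: "complex \<Rightarrow> complex \<Rightarrow> real \<Rightarrow> complex" where
  "potential a b x = a * exp (- (\<i> * 2 * of_real x)) + b * exp (\<i> * 2 * of_real x)"

definition op_P :: "complex \<Rightarrow> complex \<Rightarrow> (l2 \<times> l2) set" where
  "op_P a b = {(abs_l2 y, abs_l2 (\<lambda>x. - y2 x + potential a b x * y x)) | y y1 y2.
     sobolev2 y y1 y2 \<and> y pi = y 0 \<and> y1 pi = y1 0}"

definition op_A :: "complex \<Rightarrow> complex \<Rightarrow> (l2 \<times> l2) set" where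
  "op_A a b = {(abs_l2 y, abs_l2 (\<lambda>x. - y2 x + potential a b x * y x)) | y y1 y2.
     sobolev2 y y1 y2 \<and> y pi = - y 0 \<and> y1 pi = - y1 0}"

end

theory Submission
  imports Defs
begin

text \<open>
  Let \<open>c n\<close> be the Fourier coefficients of an eigenfunction, rescaled by \<open>t\<^sup>n\<close> with \<open>t\<^sup>2 = a / b\<close>. They
  satisfy \<open>(\<mu> - D n) * c n = q * (c (n + 1) + c (n - 1))\<close> with \<open>q\<^sup>2 = a * b\<close> and \<open>D n = (2 * n)\<^sup>2\<close> or
  \<open>(2 * n + 1)\<^sup>2\<close>, and decay faster than any geometric sequence. The Casoratian of two solutions is
  constant and tends to 0, so eigenspaces are one-dimensional and \<open>c\<close> is even or odd under reflection.
  If there were an associated function, the Casoratian with it would show that the squares \<open>c n ^ 2\<close> sum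
  to 0, so no coefficient carries more than half of the \<open>l\<^sup>2\<close> mass.

  This is impossible for small \<open>q\<close>. If \<open>\<mu>\<close> lies to the right of the two lowest diagonal entries, the
  coefficient whose diagonal entry is nearest to \<open>\<mu>\<close> does dominate. Otherwise the two lowest
  coefficients carry almost everything; vanishing of the sum of squares then forces, up to small terms,
  the discriminant of the upper left 2 x 2 block to vanish, which needs a larger \<open>q\<close>.
\<close>

section \<open>Three-term recurrences on the integers\<close>

lemma recurrence_solution_decay:
  fixes z e :: "nat \<Rightarrow> complex"
  assumes e: "filterlim (\<lambda>n. cmod (e n)) at_top sequentially"
    and rec: "\<And>n. e (Suc n) * z (Suc n) = q * (z (Suc (Suc n)) + z n)"
    and growth: "\<And>n. cmod (z n) \<le> M * T ^ n" and T: "T \<ge> 1" and r: "r > 0"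
  shows "\<exists>C. \<forall>n. cmod (z n) \<le> C * r ^ n"
proof -
  have M: "M \<ge> 0" using growth[of 0] norm_ge_zero[of "z 0"] by (simp del: norm_ge_zero)
  define \<rho> where "\<rho> = r / T"
  have \<rho>: "\<rho> > 0" using r T by (simp add: \<rho>_def)
  \<comment> \<open>A diagonal entry of modulus at least \<open>K\<close> beats the two neighbours,
    which together cost \<open>2 * cmod q * T\<close>, and still gains a factor
    \<open>\<rho>\<close>. The summand 1 keeps \<open>K\<close> positive for
    \<open>q = 0\<close>.\<close>
  define K where "K = 2 * cmod q * T / \<rho> + 1"
  have K: "K > 0" using \<rho> T by (simp add: K_def add_nonneg_pos)
  have qK: "2 * cmod q * T \<le> \<rho> * K" using \<rho> by (simp add: K_def field_simps)
  obtain N where N: "\<And>n. n \<ge> N \<Longrightarrow> K \<le> cmod (e n)"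
    using e unfolding filterlim_at_top eventually_sequentially by blast
  \<comment> \<open>Bootstrapping: each use of the recurrence gains a factor \<open>\<rho>\<close>
    at the price of starting one index later. Taking \<open>j = n - N\<close> turns the rate
    \<open>T\<close> into \<open>T * \<rho> = r\<close>.\<close>
  have P: "\<forall>n \<ge> N + j. cmod (z n) \<le> M * T ^ n * \<rho> ^ j" for j
  proof (induction j)
    case 0 show ?case using growth by simp
  next
    case (Suc j)
    show ?case
    proof (intro allI impI)
      fix n assume n: "n \<ge> N + Suc j"
      then obtain k where k: "n = Suc k" "k \<ge> N + j" by (metis Suc_le_D add_Suc_right Suc_le_mono)
      have "K * cmod (z n) \<le> cmod (e n * z n)"
        using N[of n] n by (simp add: norm_mult mult_right_mono)
      also have "\<dots> = cmod q * cmod (z (Suc (Suc k)) + z k)"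
        using rec[of k] k by (simp add: norm_mult)
      also have "\<dots> \<le> cmod q * (M * T ^ Suc (Suc k) * \<rho> ^ j + M * T ^ k * \<rho> ^ j)"
        using Suc.IH[rule_format, of "Suc (Suc k)"] Suc.IH[rule_format, of k] k
        by (intro mult_left_mono order_trans[OF norm_triangle_ineq] add_mono) (simp_all del: power_Suc)
      also have "\<dots> \<le> cmod q * (M * T ^ Suc (Suc k) * \<rho> ^ j + M * T ^ Suc (Suc k) * \<rho> ^ j)"
        using M \<rho> T by (intro mult_left_mono add_mono mult_right_mono power_increasing) auto
      also have "\<dots> = (2 * cmod q * T) * (M * T ^ n * \<rho> ^ j)" using k by simp
      also have "\<dots> \<le> (\<rho> * K) * (M * T ^ n * \<rho> ^ j)"
        using M \<rho> T by (intro mult_right_mono qK) auto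
      finally have "K * cmod (z n) \<le> K * (M * T ^ n * \<rho> ^ Suc j)" by (simp add: ac_simps)
      with K show "cmod (z n) \<le> M * T ^ n * \<rho> ^ Suc j" by simp
    qed
  qed
  define C where "C = M / \<rho> ^ N + (\<Sum>i<N. cmod (z i) / r ^ i)"
  have "cmod (z n) \<le> C * r ^ n" for n
  proof (cases "n < N")
    case True
    have "cmod (z n) / r ^ n \<le> (\<Sum>i<N. cmod (z i) / r ^ i)"
      using True r by (intro member_le_sum) auto
    also have "\<dots> \<le> C" using M \<rho> by (simp add: C_def)
    finally show ?thesis using r by (simp add: field_simps)
  next
    case False
    then obtain j where j: "n = N + j" by (metis le_Suc_ex not_less)
    have "cmod (z n) \<le> M * T ^ n * \<rho> ^ j" using P j by auto
    also have "\<dots> = M / \<rho> ^ N * r ^ n"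
      using r T \<rho> by (simp add: \<rho>_def j power_add power_divide)
    also have "\<dots> \<le> C * r ^ n"
      using r by (intro mult_right_mono) (auto simp: C_def sum_nonneg)
    finally show ?thesis .
  qed
  then show ?thesis by blast
qed

definition jacobi_solution ::
  "(int \<Rightarrow> complex) \<Rightarrow> complex \<Rightarrow> complex \<Rightarrow> (int \<Rightarrow> complex) \<Rightarrow> bool" where
  "jacobi_solution D q \<mu> c \<longleftrightarrow> (\<forall>n. (\<mu> - D n) * c n = q * (c (n + 1) + c (n - 1)))"

definition geometric_growth :: "real \<Rightarrow> (int \<Rightarrow> complex) \<Rightarrow> bool" where
  "geometric_growth T c \<longleftrightarrow> (\<exists>M. \<forall>n. cmod (c n) \<le> M * T ^ nat \<bar>n\<bar>)"

definition diag_unbounded :: "(int \<Rightarrow> complex) \<Rightarrow> bool" where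
  "diag_unbounded D \<longleftrightarrow> (\<forall>\<mu>. filterlim (\<lambda>n. cmod (\<mu> - D (int n))) at_top sequentially \<and>
     filterlim (\<lambda>n. cmod (\<mu> - D (- int n))) at_top sequentially)"

text \<open>Growth at one fixed rate improves to decay at every rate. In use the a priori bound
  comes from bounded Fourier coefficients, and \<open>T\<close> accounts for the rescaling by powers
  of \<open>t\<close>.\<close>

lemma jacobi_solution_decay:
  assumes D: "diag_unbounded D" and c: "jacobi_solution D q \<mu> c"
    and g: "geometric_growth T c" and T: "T \<ge> 1" and r: "r > 0"
  shows "geometric_growth r c"
proof -
  obtain M where M: "\<And>n. cmod (c n) \<le> M * T ^ nat \<bar>n\<bar>" using g by (auto simp: geometric_growth_def)
  have rec: "(\<mu> - D n) * c n = q * (c (n + 1) + c (n - 1))" for n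
    using c by (auto simp: jacobi_solution_def)
  obtain C1 where C1: "\<And>n::nat. cmod (c (int n)) \<le> C1 * r ^ n"
  proof -
    have "(\<mu> - D (int (Suc n))) * c (int (Suc n)) = q * (c (int (Suc (Suc n))) + c (int n))" for n
      using rec[of "int (Suc n)"] by (simp add: ac_simps)
    from recurrence_solution_decay[where e = "\<lambda>n. \<mu> - D (int n)" and z = "\<lambda>n. c (int n)", OF _ this _ T r, of M]
      D M[of "int _"] that show ?thesis
      by (auto simp: diag_unbounded_def)
  qed
  obtain C2 where C2: "\<And>n::nat. cmod (c (- int n)) \<le> C2 * r ^ n"
  proof -
    have "(\<mu> - D (- int (Suc n))) * c (- int (Suc n)) = q * (c (- int (Suc (Suc n))) + c (- int n))" for n
      using rec[of "- int (Suc n)"] by (simp add: algebra_simps)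
    from recurrence_solution_decay[where e = "\<lambda>n. \<mu> - D (- int n)" and z = "\<lambda>n. c (- int n)", OF _ this _ T r, of M]
      D M[of "- int _"] that show ?thesis
      by (auto simp: diag_unbounded_def)
  qed
  have "cmod (c n) \<le> max C1 C2 * r ^ nat \<bar>n\<bar>" for n
  proof (cases "n \<ge> 0")
    case True
    then show ?thesis using C1[of "nat n"] r
      by (auto intro: order_trans[OF _ mult_right_mono] simp: nat_abs_int_diff)
  next
    case False
    then show ?thesis using C2[of "nat (- n)"] r
      by (auto intro: order_trans[OF _ mult_right_mono])
  qed
  then show ?thesis by (auto simp: geometric_growth_def)
qed

section \<open>The Casoratian (discrete Wronskian) and uniqueness of decaying solutions\<close>

definition casoratian :: "(int \<Rightarrow> complex) \<Rightarrow> (int \<Rightarrow> complex) \<Rightarrow> int \<Rightarrow> complex" where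
  "casoratian c v n = c n * v (n + 1) - c (n + 1) * v n"

text \<open>Decay of \<open>c\<close> at rate \<open>1 / (2 * T)\<close> outweighs growth of
  \<open>v\<close> at rate \<open>T\<close> and leaves \<open>1/2\<close>. Only growth is asked of
  \<open>v\<close>, since an associated function satisfies an inhomogeneous recurrence, to which the
  decay lemma does not apply.\<close>

lemma casoratian_tendsto_0:
  assumes c: "\<And>r. r > 0 \<Longrightarrow> geometric_growth r c" and v: "geometric_growth T v" and T: "T \<ge> 1"
  shows "(\<lambda>n. casoratian c v (int n + k)) \<longlonglongrightarrow> 0" "(\<lambda>n. casoratian c v (- int n + k)) \<longlonglongrightarrow> 0"
proof -
  have Tr: "1 / (2 * T) > 0" using T by simp
  obtain M where M: "\<And>n. cmod (v n) \<le> M * T ^ nat \<bar>n\<bar>" using v by (auto simp: geometric_growth_def)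
  obtain C where C: "\<And>n. cmod (c n) \<le> C * (1 / (2 * T)) ^ nat \<bar>n\<bar>"
    using c[OF Tr] by (auto simp: geometric_growth_def)
  have M0: "M \<ge> 0" using M[of 0] norm_ge_zero[of "v 0"] by (simp del: norm_ge_zero)
  have C0: "C \<ge> 0" using C[of 0] norm_ge_zero[of "c 0"] by (simp del: norm_ge_zero)
  have p: "cmod (c i * v j) \<le> C * M * T * (1/2) ^ nat \<bar>i\<bar>" if "\<bar>i - j\<bar> \<le> 1" for i j
  proof -
    have "cmod (c i * v j) \<le> (C * (1 / (2 * T)) ^ nat \<bar>i\<bar>) * (M * T ^ nat \<bar>j\<bar>)"
      unfolding norm_mult using C M C0 T by (intro mult_mono) auto
    also have "\<dots> \<le> (C * (1 / (2 * T)) ^ nat \<bar>i\<bar>) * (M * T ^ Suc (nat \<bar>i\<bar>))"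
      using M0 C0 T that by (intro mult_left_mono power_increasing) auto
    also have "\<dots> = C * M * T * (1/2) ^ nat \<bar>i\<bar>"
      using T by (simp add: power_divide power_mult_distrib)
    finally show ?thesis .
  qed
  have b: "cmod (casoratian c v n) \<le> C * M * T * (1/2) ^ nat \<bar>n\<bar> + C * M * T * (1/2) ^ nat \<bar>n + 1\<bar>" for n
    unfolding casoratian_def
    by (rule order_trans[OF norm_triangle_ineq4 add_mono[OF p p]]) auto
  have l: "(\<lambda>n. C * M * T * (1/2) ^ nat \<bar>f n\<bar> + C * M * T * (1/2) ^ nat \<bar>f n + 1\<bar>) \<longlonglongrightarrow> 0"
    if f: "filterlim (\<lambda>n. nat \<bar>f n\<bar>) at_top sequentially" "filterlim (\<lambda>n. nat \<bar>f n + 1\<bar>) at_top sequentially" for f :: "nat \<Rightarrow> int"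
  proof -
    have h: "(\<lambda>n. (1/2::real) ^ n) \<longlonglongrightarrow> 0" by (rule LIMSEQ_power_zero) simp
    show ?thesis
      using tendsto_add[OF tendsto_mult_right_zero[OF filterlim_compose[OF h f(1)]]
        tendsto_mult_right_zero[OF filterlim_compose[OF h f(2)]], of "C * M * T" "C * M * T"] by simp
  qed
  have f1: "filterlim (\<lambda>n. nat \<bar>int n + k\<bar>) at_top sequentially" for k
    unfolding filterlim_at_top eventually_sequentially
  proof
    fix Z show "\<exists>N. \<forall>n\<ge>N. Z \<le> nat \<bar>int n + k\<bar>" by (rule exI[of _ "nat \<bar>k\<bar> + Z"]) auto
  qed
  have f2: "filterlim (\<lambda>n. nat \<bar>- int n + k\<bar>) at_top sequentially" for k
    unfolding filterlim_at_top eventually_sequentially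
  proof
    fix Z show "\<exists>N. \<forall>n\<ge>N. Z \<le> nat \<bar>- int n + k\<bar>" by (rule exI[of _ "nat \<bar>k\<bar> + Z"]) auto
  qed
  show "(\<lambda>n. casoratian c v (int n + k)) \<longlonglongrightarrow> 0"
    by (rule Lim_null_comparison[OF always_eventually[OF allI[OF b]]], rule l)
      (use f1[of k] f1[of "k+1"] in \<open>auto simp: add.assoc\<close>)
  show "(\<lambda>n. casoratian c v (- int n + k)) \<longlonglongrightarrow> 0"
    by (rule Lim_null_comparison[OF always_eventually[OF allI[OF b]]], rule l)
      (use f2[of k] f2[of "k+1"] in \<open>simp_all add: algebra_simps\<close>)
qed

text \<open>Discrete Lagrange identity: cross-multiplying the two equations cancels the diagonal.
  With \<open>s = 0\<close> it gives constancy for two solutions; \<open>s \<noteq> 0\<close> is the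
  case of an associated function \<open>v\<close> over \<open>c\<close>.\<close>

lemma casoratian_step:
  assumes c: "jacobi_solution D q \<mu> c"
    and v: "\<And>n. (\<mu> - D n) * v n + s * c n = q * (v (n + 1) + v (n - 1))"
  shows "q * (casoratian c v n - casoratian c v (n - 1)) = s * (c n)\<^sup>2"
proof -
  have "(\<mu> - D n) * c n = q * (c (n + 1) + c (n - 1))" using c by (auto simp: jacobi_solution_def)
  with v[of n] show ?thesis unfolding casoratian_def by (simp add: power2_eq_square) algebra
qed

lemma casoratian_sum:
  assumes c: "jacobi_solution D q \<mu> c"
    and v: "\<And>n. (\<mu> - D n) * v n + s * c n = q * (v (n + 1) + v (n - 1))"
  shows "s * (\<Sum>n<N. (c (int n + k))\<^sup>2) = q * (casoratian c v (int N + k - 1) - casoratian c v (k - 1))"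
proof (induction N)
  case (Suc N)
  then show ?case using casoratian_step[OF c v, of "int N + k"] by (simp add: algebra_simps)
qed simp

lemma jacobi_solution_zero:
  assumes c: "jacobi_solution D q \<mu> c" and q: "q \<noteq> 0" and z: "c 0 = 0" "c 1 = 0"
  shows "c n = 0"
proof -
  have rec: "(\<mu> - D n) * c n = q * (c (n + 1) + c (n - 1))" for n
    using c by (auto simp: jacobi_solution_def)
  have "c (int n) = 0 \<and> c (int n + 1) = 0" for n
  proof (induction n)
    case (Suc n)
    then show ?case using rec[of "int n + 1"] q by (simp add: ac_simps)
  qed (use z in auto)
  moreover have "c (- int n) = 0 \<and> c (- int n + 1) = 0" for n
  proof (induction n)
    case (Suc n)
    moreover have e: "- int n - 1 = - int (Suc n)" "- int (Suc n) + 1 = - int n" by simp_all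
    ultimately show ?case using rec[of "- int n", unfolded e] q unfolding e by (simp del: of_nat_Suc)
  qed (use z in auto)
  ultimately show ?thesis by (cases n) (auto simp del: of_nat_Suc)
qed

lemma jacobi_solution_proportional:
  assumes c: "jacobi_solution D q \<mu> c" and v: "jacobi_solution D q \<mu> v" and q: "q \<noteq> 0"
    and cd: "\<And>r. r > 0 \<Longrightarrow> geometric_growth r c" and vd: "geometric_growth T v" and T: "T \<ge> 1"
    and nz: "c m \<noteq> 0"
  shows "\<exists>s. \<forall>n. v n = s * c n"
proof -
  have step: "casoratian c v n = casoratian c v (n - 1)" for n
    using casoratian_step[OF c, of v 0 n] v q by (auto simp: jacobi_solution_def)
  have "casoratian c v (int n) = casoratian c v 0" for n
    by (induction n) (use step[of "int _ + 1"] in \<open>auto simp: ac_simps\<close>)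
  with casoratian_tendsto_0(1)[OF cd vd T, of 0] have W: "casoratian c v 0 = 0"
    by (simp add: LIMSEQ_const_iff)
  have "c 0 \<noteq> 0 \<or> c 1 \<noteq> 0" using jacobi_solution_zero[OF c q] nz by blast
  then obtain s where s: "v 0 = s * c 0" "v 1 = s * c 1"
  proof
    assume "c 0 \<noteq> 0" then show thesis using W that[of "v 0 / c 0"] by (simp add: casoratian_def field_simps)
  next
    assume "c 1 \<noteq> 0" then show thesis using W that[of "v 1 / c 1"] by (simp add: casoratian_def field_simps)
  qed
  have "jacobi_solution D q \<mu> (\<lambda>n. v n - s * c n)"
    using c v unfolding jacobi_solution_def by (simp add: algebra_simps)
  from jacobi_solution_zero[OF this q] s show ?thesis by auto
qed

section \<open>Isotropic solutions of half-line recurrences\<close>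

text \<open>In use \<open>h k\<close> is the distance of \<open>\<mu>\<close> from diagonal entry
  \<open>k + 2\<close>, so rows 0 and 1 stay untouched. Summing the squared rows from 3 on bounds
  the mass beyond index 2 by itself and by \<open>N 2\<close>; the self-referring part is absorbed
  by \<open>gap\<close>, which leaves the ratio \<open>s\<close>. Row 2 alone, with its own distance
  bound \<open>L\<close>, then yields the ratio \<open>r\<close>.\<close>

lemma jacobi_tail_bound:
  fixes x :: "nat \<Rightarrow> complex" and h :: "nat \<Rightarrow> real"
  assumes rec: "\<And>k. h k * cmod (x (k + 2)) \<le> Q * (cmod (x (k + 1)) + cmod (x (k + 3)))"
    and summ: "summable (\<lambda>k. (cmod (x k))\<^sup>2)"
    and h0: "L \<le> h 0" and h1: "\<And>k. L' \<le> h (Suc k)" and pos: "0 \<le> Q" "0 \<le> L'" "0 \<le> s" "0 \<le> r"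
    and gap: "4 * Q\<^sup>2 < L'\<^sup>2" and s: "2 * Q\<^sup>2 \<le> s\<^sup>2 * (L'\<^sup>2 - 4 * Q\<^sup>2)"
    and sL: "s * Q < L" and r: "Q \<le> r * (L - s * Q)"
  shows "cmod (x 2) \<le> r * cmod (x 1)"
    and "(\<Sum>k. (cmod (x (k + 2)))\<^sup>2) \<le> r\<^sup>2 * (1 + s\<^sup>2) * (cmod (x 1))\<^sup>2"
proof -
  define N where "N k = (cmod (x k))\<^sup>2" for k
  have N0: "N k \<ge> 0" for k by (simp add: N_def)
  have sN: "summable (\<lambda>k. N (k + j))" for j
    using summ by (simp add: N_def summable_iff_shift[of "\<lambda>k. (cmod (x k))\<^sup>2"])
  define S where "S = (\<Sum>k. N (k + 3))"
  have S2: "(\<Sum>k. N (k + 2)) = N 2 + S"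
    using suminf_split_head[OF sN[of 2]] by (simp add: S_def numeral_eq_Suc)
  have S4: "(\<Sum>k. N (k + 4)) \<le> S"
    using suminf_split_head[OF sN[of 3]] N0[of 3] by (simp add: S_def numeral_eq_Suc)
  have row: "L'\<^sup>2 * N (k + 3) \<le> 2 * Q\<^sup>2 * (N (k + 2) + N (k + 4))" for k
  proof -
    have "L' * cmod (x (k + 3)) \<le> h (Suc k) * cmod (x (k + 3))"
      by (intro mult_right_mono h1) auto
    also have "\<dots> \<le> Q * (cmod (x (k + 2)) + cmod (x (k + 4)))"
      using rec[of "Suc k"] by (simp add: numeral_eq_Suc)
    finally have "(L' * cmod (x (k + 3)))\<^sup>2 \<le> (Q * (cmod (x (k + 2)) + cmod (x (k + 4))))\<^sup>2"
      using pos by (intro power_mono) auto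
    also have "\<dots> \<le> Q\<^sup>2 * (2 * (cmod (x (k + 2)))\<^sup>2 + 2 * (cmod (x (k + 4)))\<^sup>2)"
      unfolding power_mult_distrib
      using sum_squares_bound[of "cmod (x (k + 2))" "cmod (x (k + 4))"]
      by (intro mult_left_mono) (auto simp: power2_sum)
    finally show ?thesis by (simp add: N_def power_mult_distrib algebra_simps)
  qed
  have "L'\<^sup>2 * S = (\<Sum>k. L'\<^sup>2 * N (k + 3))"
    unfolding S_def by (rule suminf_mult[symmetric, OF sN])
  also have "\<dots> \<le> (\<Sum>k. 2 * Q\<^sup>2 * (N (k + 2) + N (k + 4)))"
    by (intro suminf_le row summable_mult summable_add sN)
  also have "\<dots> = 2 * Q\<^sup>2 * ((\<Sum>k. N (k + 2)) + (\<Sum>k. N (k + 4)))"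
    unfolding suminf_add[OF sN sN] by (rule suminf_mult[OF summable_add[OF sN sN]])
  also have "\<dots> \<le> 2 * Q\<^sup>2 * (N 2 + S + S)"
    using S2 S4 by (intro mult_left_mono) auto
  finally have "(L'\<^sup>2 - 4 * Q\<^sup>2) * S \<le> 2 * Q\<^sup>2 * N 2" by (simp add: algebra_simps)
  also have "\<dots> \<le> (L'\<^sup>2 - 4 * Q\<^sup>2) * (s\<^sup>2 * N 2)"
    using mult_right_mono[OF s N0[of 2]] by (simp add: ac_simps)
  finally have S: "S \<le> s\<^sup>2 * N 2" using gap by simp
  have "N 3 \<le> S"
    using suminf_split_head[OF sN[of 3]] suminf_nonneg[OF sN[of 4]] N0 by (simp add: S_def numeral_eq_Suc)
  with S have "(cmod (x 3))\<^sup>2 \<le> (s * cmod (x 2))\<^sup>2" by (simp add: N_def power_mult_distrib)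
  then have x3: "cmod (x 3) \<le> s * cmod (x 2)"
    using pos by (auto dest: power2_le_imp_le)
  have "L * cmod (x 2) \<le> h 0 * cmod (x 2)" by (intro mult_right_mono h0) auto
  also have "\<dots> \<le> Q * (cmod (x 1) + cmod (x 3))" using rec[of 0] by (simp add: numeral_eq_Suc)
  also have "\<dots> \<le> Q * (cmod (x 1) + s * cmod (x 2))" using x3 pos by (intro mult_left_mono) auto
  finally have "(L - s * Q) * cmod (x 2) \<le> Q * cmod (x 1)" by (simp add: algebra_simps)
  also have "\<dots> \<le> (L - s * Q) * (r * cmod (x 1))"
    using mult_right_mono[OF r norm_ge_zero[of "x 1"]] by (simp add: ac_simps)
  finally show x2: "cmod (x 2) \<le> r * cmod (x 1)" using sL by simp
  have "N 2 \<le> r\<^sup>2 * N 1"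
    using power_mono[OF x2, of 2] by (simp add: N_def power_mult_distrib)
  then have "(1 + s\<^sup>2) * N 2 \<le> (1 + s\<^sup>2) * (r\<^sup>2 * N 1)" by (intro mult_left_mono) auto
  with S S2 show "(\<Sum>k. (cmod (x (k + 2)))\<^sup>2) \<le> r\<^sup>2 * (1 + s\<^sup>2) * (cmod (x 1))\<^sup>2"
    by (simp add: N_def algebra_simps)
qed

text \<open>With \<open>z = x0 / x1\<close> the hypotheses give \<open>\<alpha> = p / z\<close>, \<open>\<beta> = p * z\<close> and \<open>z\<^sup>2 = - (1 + \<tau>)\<close>; the witness is
  \<open>w = (2 + \<tau>) / z\<close>, close to \<open>\<plusminus> 2 * \<i>\<close> for small \<open>\<tau>\<close>.\<close>

lemma isotropic_head:
  fixes x0 x1 \<tau> p \<alpha> \<beta> :: complex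
  assumes eqs: "\<alpha> * x0 = p * x1" "\<beta> * x1 = p * x0" and iso: "x0\<^sup>2 + (1 + \<tau>) * x1\<^sup>2 = 0"
    and x1: "x1 \<noteq> 0" and t: "cmod \<tau> \<le> t" "t < 1"
  shows "\<exists>w. \<alpha> - \<beta> = p * w \<and> cmod (w\<^sup>2 + 4) \<le> t\<^sup>2 / (1 - t)"
    and "cmod (\<alpha> + \<beta>) \<le> cmod p * t / sqrt (1 - t)"
proof -
  define z where "z = x0 / x1"
  have t0: "t \<ge> 0" using t(1) norm_ge_zero order_trans by blast
  have "x0\<^sup>2 = - (1 + \<tau>) * x1\<^sup>2" using iso by algebra
  then have z2: "z\<^sup>2 = - (1 + \<tau>)" using x1 by (simp add: z_def power_divide)
  have n1: "1 - t \<le> cmod (1 + \<tau>)"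
    using norm_triangle_ineq4[of "1 + \<tau>" \<tau>] t by simp
  then have nz: "1 + \<tau> \<noteq> 0" using t by auto
  then have z: "z \<noteq> 0" using z2 by auto
  have x0: "x0 = z * x1" using x1 by (simp add: z_def)
  have \<alpha>: "\<alpha> = p / z" and \<beta>: "\<beta> = p * z"
    using eqs x1 z by (auto simp: x0 field_simps)
  define w where "w = (2 + \<tau>) / z"
  have "\<alpha> - \<beta> = p * w"
    using z z2 by (simp add: \<alpha> \<beta> w_def field_simps power2_eq_square) algebra
  \<comment> \<open>\<open>(2 + \<tau>)\<^sup>2\<close> and \<open>4 * (1 + \<tau>)\<close> differ
    by \<open>\<tau>\<^sup>2\<close> only. So \<open>\<alpha> - \<beta>\<close> is controlled to
    second order in the tail, while \<open>\<alpha> + \<beta>\<close> is small to first order. Later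
    the sum locates \<open>\<mu>\<close> and the difference gives the contradiction.\<close>
  moreover have "w\<^sup>2 + 4 = - (\<tau>\<^sup>2 / (1 + \<tau>))"
    using nz unfolding w_def power_divide z2 by (simp add: divide_simps) algebra
  moreover have "cmod (\<tau>\<^sup>2 / (1 + \<tau>)) \<le> t\<^sup>2 / (1 - t)"
    unfolding norm_divide norm_power using n1 t by (intro frac_le power_mono) auto
  ultimately show "\<exists>w. \<alpha> - \<beta> = p * w \<and> cmod (w\<^sup>2 + 4) \<le> t\<^sup>2 / (1 - t)" by auto
  have ab: "\<alpha> + \<beta> = - (p * \<tau> / z)"
    using z z2 by (simp add: \<alpha> \<beta> field_simps power2_eq_square) algebra
  have "(sqrt (1 - t))\<^sup>2 \<le> (cmod z)\<^sup>2"
    using n1 t z2 by (simp add: norm_power[symmetric] norm_minus_cancel del: minus_add_distrib)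
  then have "sqrt (1 - t) \<le> cmod z" by (rule power2_le_imp_le) auto
  then show "cmod (\<alpha> + \<beta>) \<le> cmod p * t / sqrt (1 - t)"
    unfolding ab norm_minus_cancel norm_divide norm_mult using t t0 z
    by (intro frac_le mult_left_mono) auto
qed

text \<open>\<open>w\<close> is near \<open>\<plusminus> 2 * \<i>\<close>, hence almost
  perpendicular to the real number \<open>s\<close>, and the value is about 4 + 1 instead of 9. The
  real part of \<open>w\<close> is controlled by adding the bounds on the real part and on the
  modulus of \<open>w\<^sup>2\<close>.\<close>

lemma cmod_add_unit_le:
  assumes w: "cmod (w\<^sup>2 + 4) \<le> \<eta>" and s: "s = 1 \<or> s = (-1::complex)"
  shows "(cmod (w + s))\<^sup>2 \<le> 5 + \<eta> + 2 * sqrt \<eta>"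
proof -
  have "\<eta> \<ge> 0" using w norm_ge_zero order_trans by blast
  have n: "(cmod w)\<^sup>2 \<le> 4 + \<eta>"
    using norm_triangle_ineq4[of "w\<^sup>2 + 4" 4] w by (simp add: norm_power)
  have "Re (w\<^sup>2 + 4) \<ge> - \<eta>" "Re (w\<^sup>2 + 4) \<le> \<eta>"
    using abs_Re_le_cmod[of "w\<^sup>2 + 4"] w by auto
  then have "(Re w)\<^sup>2 \<le> \<eta>"
    using n by (simp add: cmod_power2 Re_power2)
  then have "\<bar>Re w\<bar> \<le> sqrt \<eta>" using real_le_rsqrt[of "\<bar>Re w\<bar>"] by auto
  moreover have "(cmod (w + s))\<^sup>2 \<le> 1 + 2 * \<bar>Re w\<bar> + (cmod w)\<^sup>2"
    unfolding cmod_power2 using s by (auto simp: power2_eq_square algebra_simps)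
  ultimately show ?thesis using n by simp
qed

text \<open>\<open>\<tau>\<close> is the sum of the squares from index 2 on in units of
  \<open>(x 1)\<^sup>2\<close>. Isotropy of the sequence thereby becomes a perturbed isotropy of its
  first two entries.\<close>

lemma isotropic_tail:
  fixes x :: "nat \<Rightarrow> complex"
  assumes summ: "summable (\<lambda>k. (cmod (x k))\<^sup>2)" and iso: "(\<Sum>k. (x k)\<^sup>2) = 0"
    and tail: "(\<Sum>k. (cmod (x (k + 2)))\<^sup>2) \<le> t * (cmod (x 1))\<^sup>2" and x1: "x 1 \<noteq> 0"
  shows "\<exists>\<tau>. (x 0)\<^sup>2 + (1 + \<tau>) * (x 1)\<^sup>2 = 0 \<and> cmod \<tau> \<le> t"
proof -
  have s: "summable (\<lambda>k. (x k)\<^sup>2)"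
    by (rule summable_norm_cancel) (use summ in \<open>simp add: norm_power\<close>)
  have s1: "summable (\<lambda>k. (x (Suc k))\<^sup>2)" by (rule summable_Suc_iff[THEN iffD2, OF s])
  have s2: "summable (\<lambda>k. norm ((x (k + 2))\<^sup>2))"
    using summable_ignore_initial_segment[OF summ, of 2] by (simp add: norm_power)
  define \<tau> where "\<tau> = (\<Sum>k. (x (k + 2))\<^sup>2) / (x 1)\<^sup>2"
  have "(x 0)\<^sup>2 + (x 1)\<^sup>2 + (\<Sum>k. (x (k + 2))\<^sup>2) = 0"
    using suminf_split_head[OF s] suminf_split_head[OF s1] iso by (simp add: numeral_eq_Suc)
  then have "(x 0)\<^sup>2 + (1 + \<tau>) * (x 1)\<^sup>2 = 0" using x1 by (simp add: \<tau>_def algebra_simps)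
  moreover have "norm (\<Sum>k. (x (k + 2))\<^sup>2) \<le> t * (cmod (x 1))\<^sup>2"
    using summable_norm[OF s2] tail by (simp add: norm_power)
  then have "cmod \<tau> \<le> t" using x1 by (simp add: \<tau>_def norm_divide norm_power field_simps)
  ultimately show ?thesis by blast
qed

text \<open>\<open>N k\<close> stands for \<open>\<bar>x k\<bar>\<^sup>2\<close> and \<open>H k\<close> for \<open>\<bar>\<mu> - d k\<bar>\<^sup>2\<close>. Adding up the rows other than \<open>m\<close>, each \<open>N k\<close> gets weight
  at most 2 (neighbours of \<open>m\<close>) or 8, and \<open>N m\<close>, which gets weight \<open>7/2\<close>, is at most the sum of the
  others. The unequal coefficients in the rows keep the neighbour weights low; equal coefficients
  would only just fail at the constant \<open>64 / 6\<close>.\<close>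

lemma isotropic_dominance:
  fixes N H :: "nat \<Rightarrow> real"
  assumes N0: "\<And>k. 0 \<le> N k" and summ: "summable N" and P: "0 < P" and m: "2 \<le> m"
    and row0: "H 0 * N 0 \<le> P * (2 * N 0 + 2 * N 1)"
    and below: "\<And>k. Suc k < m \<Longrightarrow> H (Suc k) * N (Suc k) \<le> P * (6 * N k + 2 * N (Suc (Suc k)))"
    and above: "\<And>k. m \<le> k \<Longrightarrow> H (Suc k) * N (Suc k) \<le> P * (3/2 * N k + 3 * N (Suc (Suc k)))"
    and near: "\<And>k. k = m + 1 \<or> k + 1 = m \<Longrightarrow> 11/2 * P < H k"
    and far: "\<And>k. k \<noteq> m \<Longrightarrow> k \<noteq> m + 1 \<Longrightarrow> k + 1 \<noteq> m \<Longrightarrow> 23/2 * P < H k"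
    and iso: "2 * N m \<le> suminf N"
  shows "N k = 0"
proof -
  \<comment> \<open>\<open>A\<close> and \<open>B\<close> hold the contributions of the lower and of
    the upper neighbour to each row, with row \<open>m\<close> left out. Row 0 has no lower
    neighbour and keeps its own term \<open>2 * N 0\<close> in \<open>A 0\<close>.\<close>
  define A where "A k = (if k = m then 0 else if k = 0 then 2 * N 0 else if k < m then 6 * N (k - 1) else 3/2 * N (k - 1))" for k
  define B where "B k = (if k = m then 0 else if k < m then 2 * N (k + 1) else 3 * N (k + 1))" for k
  define B' where "B' k = (if k = 0 then 0 else B (k - 1))" for k
  define N' where "N' k = (if k = m then 0 else N k)" for k
  define w where "w k = (if k = m + 1 \<or> k + 1 = m then 2 else 8::real)" for k
  have sSuc: "summable (\<lambda>k. N (Suc k))" using summ by (simp add: summable_Suc_iff)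
  have sB: "summable B"
    by (rule summable_comparison_test[OF _ summable_mult[OF sSuc, of 3]]) (auto simp: B_def N0 intro!: exI[of _ 0])
  have sA1: "summable (\<lambda>k. A (Suc k))"
    by (rule summable_comparison_test[OF _ summable_mult[OF summ, of 6]]) (auto simp: A_def N0 intro!: exI[of _ 0])
  have sA: "summable A" using sA1 by (simp add: summable_Suc_iff)
  have sB': "summable B'" using sB by (subst summable_Suc_iff[symmetric]) (simp add: B'_def)
  have SA: "suminf A = A 0 + (\<Sum>k. A (Suc k))" using suminf_split_head[OF sA] by simp
  have SB: "suminf B = suminf B'" using suminf_split_head[OF sB'] by (simp add: B'_def)
  have sN': "summable N'"
    by (rule summable_comparison_test[OF _ summ]) (auto simp: N'_def N0 intro!: exI[of _ 0])
  define A0 where "A0 k = (if k = 0 then 2 * N 0 else 0)" for k :: nat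
  have A0: "A0 sums A 0" using m sums_single[of 0 "\<lambda>_. 2 * N 0"] by (simp add: A0_def[abs_def] A_def)
  have swN': "summable (\<lambda>k. w k * N' k)"
    by (rule summable_comparison_test[OF _ summable_mult[OF sN', of 8]]) (auto simp: w_def N'_def N0 intro!: exI[of _ 0])
  have pw: "A (Suc k) + B' k + A0 k \<le> w k * N' k + 7/2 * (if k = m then N m else 0)" for k
  proof (cases "k = m")
    case True
    then show ?thesis using m by (auto simp: A_def B'_def B_def A0_def N'_def)
  next
    case False
    then show ?thesis using N0[of k] m by (cases k) (auto simp: A_def B'_def B_def A0_def w_def N'_def)
  qed
  have sm: "(\<lambda>k. if k = m then N m else 0) sums N m" using sums_single[of m "\<lambda>_. N m"] by simp
  have "suminf N = (\<Sum>k. N' k + (if k = m then N m else 0))" by (intro arg_cong[of _ _ suminf]) (auto simp: N'_def)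
  also have "\<dots> = suminf N' + N m" using sm sN' by (simp add: suminf_add[symmetric] sums_iff)
  finally have Nm: "N m \<le> suminf N'" using iso by simp
  have "suminf A + suminf B = (\<Sum>k. A (Suc k) + B' k + A0 k)"
    using SA SB sA1 sB' A0 by (simp add: suminf_add[symmetric] sums_iff summable_add)
  also have "\<dots> \<le> (\<Sum>k. w k * N' k + 7/2 * (if k = m then N m else 0))"
    using sA1 sB' A0 swN' sm by (intro suminf_le pw summable_add summable_mult) (auto simp: sums_iff)
  also have "\<dots> = (\<Sum>k. w k * N' k) + 7/2 * N m"
    by (rule sums_unique[symmetric, OF sums_add[OF summable_sums[OF swN'] sums_mult[OF sm]]])
  also have "\<dots> \<le> (\<Sum>k. w k * N' k) + 7/2 * suminf N'" using Nm by simp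
  also have "\<dots> = (\<Sum>k. (w k + 7/2) * N' k)"
    unfolding suminf_mult[symmetric, OF sN'] suminf_add[OF swN' summable_mult[OF sN']]
    by (simp add: algebra_simps)
  finally have E: "suminf A + suminf B \<le> (\<Sum>k. (w k + 7/2) * N' k)" .
  have row: "H k * N' k \<le> P * (A k + B k)" for k
  proof (cases k)
    case 0
    then show ?thesis using m row0 by (simp add: N'_def A_def B_def)
  next
    case (Suc j)
    then show ?thesis using below[of j] above[of j] by (auto simp: N'_def A_def B_def not_less_eq less_Suc_eq_le)
  qed
  define U where "U k = (H k - P * (w k + 7/2)) * N' k" for k
  \<comment> \<open>The thresholds are \<open>11/2 = 2 + 7/2\<close> and
    \<open>23/2 = 8 + 7/2\<close>: the own weight plus the share of \<open>N m\<close> that isotropy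
    passes on to the other coefficients.\<close>
  have Hw: "P * (w k + 7/2) < H k" if "k \<noteq> m" for k
    using near[of k] far[of k] that by (auto simp: w_def)
  have U0: "0 \<le> U k" for k
    using Hw[of k] N0[of k] by (auto simp: U_def N'_def intro!: mult_nonneg_nonneg)
  have swN2: "summable (\<lambda>k. P * ((w k + 7/2) * N' k))"
    using summable_add[OF swN' summable_mult[OF sN', of "7/2"]] by (intro summable_mult) (simp add: algebra_simps)
  have sHN: "summable (\<lambda>k. H k * N' k)"
  proof (rule summable_comparison_test[OF _ summable_mult[OF summable_add[OF sA sB], of P]], intro exI[of _ 0] allI impI)
    fix k
    have "H k * N' k \<ge> 0"
    proof (cases "k = m")
      case False
      have "0 \<le> P * (w k + 7/2)" using P by (simp add: w_def)
      then show ?thesis using Hw[OF False] N0[of k] by (intro mult_nonneg_nonneg) (auto simp: N'_def)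
    qed (simp add: N'_def)
    then show "norm (H k * N' k) \<le> P * (A k + B k)" using row[of k] by simp
  qed
  have sU: "summable U" using summable_diff[OF sHN swN2] by (simp add: U_def[abs_def] algebra_simps)
  have "suminf U = (\<Sum>k. H k * N' k) - (\<Sum>k. P * ((w k + 7/2) * N' k))"
    unfolding suminf_diff[OF sHN swN2] by (intro arg_cong[of _ _ suminf]) (auto simp: U_def algebra_simps)
  also have "(\<Sum>k. H k * N' k) \<le> (\<Sum>k. P * (A k + B k))"
    by (intro suminf_le row sHN summable_mult summable_add sA sB)
  also have "\<dots> = P * (suminf A + suminf B)" using sA sB by (simp add: suminf_mult suminf_add summable_add)
  also have "\<dots> \<le> P * (\<Sum>k. (w k + 7/2) * N' k)" using E P by simp
  also have "\<dots> = (\<Sum>k. P * ((w k + 7/2) * N' k))"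
    using P by (intro suminf_mult[symmetric] summable_mult_D[OF swN2]) auto
  finally have "suminf U \<le> 0" by simp
  then have "\<forall>k. U k = 0"
    using suminf_eq_zero_iff[OF sU] U0 suminf_nonneg[OF sU] by (metis order_antisym)
  then have z: "N k = 0" if "k \<noteq> m" for k using Hw[OF that] that by (auto simp: U_def N'_def dest: spec[of _ k])
  then have "N' = (\<lambda>k. 0)" by (auto simp: N'_def)
  then have "N m = 0" using Nm N0[of m] by simp
  with z show ?thesis by (cases "k = m") auto
qed

text \<open>Weighted Cauchy-Schwarz with \<open>1/3 + 2/3 = 1\<close>. The uneven split allows a
  small coefficient on the side of the dominant index.\<close>

lemma cmod_add_square_le: "(cmod (u + v))\<^sup>2 \<le> 3 * (cmod u)\<^sup>2 + 3/2 * (cmod v)\<^sup>2"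
proof -
  have "(cmod (u + v))\<^sup>2 \<le> (cmod u + cmod v)\<^sup>2" by (intro power_mono norm_triangle_ineq) auto
  also have "\<dots> \<le> 3 * (cmod u)\<^sup>2 + 3/2 * (cmod v)\<^sup>2"
    using zero_le_power2[of "2 * cmod u - cmod v"] by (simp add: power2_eq_square algebra_simps)
  finally show ?thesis .
qed

lemma isotropic_twice_le:
  fixes x :: "nat \<Rightarrow> complex"
  assumes summ: "summable (\<lambda>k. (cmod (x k))\<^sup>2)" and iso: "(\<Sum>k. (x k)\<^sup>2) = 0"
  shows "2 * (cmod (x m))\<^sup>2 \<le> (\<Sum>k. (cmod (x k))\<^sup>2)"
proof -
  have s: "(\<lambda>k. (x k)\<^sup>2) sums 0"
    using iso summable_norm_cancel[of "\<lambda>k. (x k)\<^sup>2"] summ by (simp add: sums_iff norm_power)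
  have "(\<lambda>k. (x k)\<^sup>2 - (if k = m then (x m)\<^sup>2 else 0)) sums (0 - (x m)\<^sup>2)"
    by (intro sums_diff s) (use sums_single[of m "\<lambda>_. (x m)\<^sup>2"] in simp)
  then have 1: "(\<lambda>k. if k = m then 0 else (x k)\<^sup>2) sums (0 - (x m)\<^sup>2)"
    by (rule sums_cong[THEN iffD1, rotated]) auto
  have "(\<lambda>k. (cmod (x k))\<^sup>2 - (if k = m then (cmod (x m))\<^sup>2 else 0)) sums ((\<Sum>k. (cmod (x k))\<^sup>2) - (cmod (x m))\<^sup>2)"
    by (intro sums_diff summable_sums summ) (use sums_single[of m "\<lambda>_. (cmod (x m))\<^sup>2"] in simp)
  then have 2: "(\<lambda>k. norm (if k = m then 0 else (x k)\<^sup>2)) sums ((\<Sum>k. (cmod (x k))\<^sup>2) - (cmod (x m))\<^sup>2)"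
    by (rule sums_cong[THEN iffD1, rotated]) (auto simp: norm_power)
  have "norm (- (x m)\<^sup>2) \<le> (\<Sum>k. (cmod (x k))\<^sup>2) - (cmod (x m))\<^sup>2"
    using summable_norm[OF sums_summable[OF 2]] sums_unique[OF 1] sums_unique[OF 2] by simp
  then show ?thesis by (simp add: norm_power)
qed

lemma ex_bracket:
  fixes f :: "nat \<Rightarrow> real"
  assumes "f 2 \<le> R" and up: "\<And>n. real n \<le> f n"
  shows "\<exists>m\<ge>2. f m \<le> R \<and> R \<le> f (Suc m)"
proof (rule ccontr)
  assume "\<not> ?thesis"
  then have n: "\<And>m. m \<ge> 2 \<Longrightarrow> f m \<le> R \<Longrightarrow> f (Suc m) \<le> R" by force
  have "f (m + 2) \<le> R" for m by (induction m) (use assms(1) n in \<open>auto simp: numeral_2_eq_2\<close>)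
  then have "real (m + 2) \<le> R" for m using up order_trans by blast
  from this[of "nat \<lceil>R\<rceil>"] show False by linarith
qed

text \<open>A common form for both boundary conditions: \<open>\<kappa>\<close> is 1 in the
  antiperiodic and \<open>sqrt 2\<close> in the periodic case, and row 0 enters only through a norm
  inequality because its shape depends on the parity.\<close>

lemma isotropic_jacobi_dominance:
  fixes x :: "nat \<Rightarrow> complex" and d :: "nat \<Rightarrow> real" and \<mu> q \<kappa> :: complex
  assumes row0: "(cmod ((\<mu> - d 0) * x 0))\<^sup>2 \<le> (cmod q)\<^sup>2 * (2 * (cmod (x 0))\<^sup>2 + 2 * (cmod (x 1))\<^sup>2)"
    and row1: "(\<mu> - d 1) * x 1 = q * (\<kappa> * x 0 + x 2)" and \<kappa>: "(cmod \<kappa>)\<^sup>2 \<le> 2"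
    and rows: "\<And>k. (\<mu> - d (k + 2)) * x (k + 2) = q * (x (k + 1) + x (k + 3))"
    and summ: "summable (\<lambda>k. (cmod (x k))\<^sup>2)" and iso: "(\<Sum>k. (x k)\<^sup>2) = 0"
    and q: "q \<noteq> 0" and m: "2 \<le> m"
    and near: "\<And>k. k = m + 1 \<or> k + 1 = m \<Longrightarrow> \<delta> \<le> \<bar>Re \<mu> - d k\<bar>"
    and far: "\<And>k. k \<noteq> m \<Longrightarrow> k \<noteq> m + 1 \<Longrightarrow> k + 1 \<noteq> m \<Longrightarrow> \<delta>' \<le> \<bar>Re \<mu> - d k\<bar>"
    and \<delta>: "0 \<le> \<delta>" "11/2 * (cmod q)\<^sup>2 < \<delta>\<^sup>2" "0 \<le> \<delta>'" "23/2 * (cmod q)\<^sup>2 < \<delta>'\<^sup>2"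
  shows "x k = 0"
proof -
  define N where "N k = (cmod (x k))\<^sup>2" for k
  define H where "H k = (cmod (\<mu> - d k))\<^sup>2" for k
  define P where "P = (cmod q)\<^sup>2"
  have HN: "H k * N k = (cmod ((\<mu> - d k) * x k))\<^sup>2" for k
    by (simp add: H_def N_def norm_mult power_mult_distrib)
  have N0: "0 \<le> N k" for k by (simp add: N_def)
  have P0: "0 < P" using q by (simp add: P_def)
  have re: "\<bar>Re \<mu> - d k\<bar> \<le> cmod (\<mu> - d k)" for k using abs_Re_le_cmod[of "\<mu> - d k"] by simp
  \<comment> \<open>Both splittings are used: rows below \<open>m\<close> put the light coefficient
    on the upper neighbour, rows above \<open>m\<close> on the lower one, so it always points
    towards \<open>m\<close>.\<close>
  have r2: "H (k + 2) * N (k + 2) \<le> P * (3 * N (k + 1) + 3/2 * N (k + 3))"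
      "H (k + 2) * N (k + 2) \<le> P * (3/2 * N (k + 1) + 3 * N (k + 3))" for k
  proof -
    have "H (k + 2) * N (k + 2) = P * (cmod (x (k + 1) + x (k + 3)))\<^sup>2"
      by (simp only: HN rows norm_mult power_mult_distrib P_def)
    then show "H (k + 2) * N (k + 2) \<le> P * (3 * N (k + 1) + 3/2 * N (k + 3))"
      "H (k + 2) * N (k + 2) \<le> P * (3/2 * N (k + 1) + 3 * N (k + 3))"
      using cmod_add_square_le[of "x (k + 1)" "x (k + 3)"] cmod_add_square_le[of "x (k + 3)" "x (k + 1)"] P0
      by (simp_all add: N_def add.commute)
  qed
  have r1: "H 1 * N 1 \<le> P * (6 * N 0 + 2 * N 2)"
  proof -
    have "(cmod (\<kappa> * x 0 + x 2))\<^sup>2 \<le> 3 * ((cmod \<kappa>)\<^sup>2 * N 0) + 3/2 * N 2"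
      using cmod_add_square_le[of "\<kappa> * x 0" "x 2"] by (simp add: N_def norm_mult power_mult_distrib)
    also have "\<dots> \<le> 6 * N 0 + 2 * N 2" using mult_right_mono[OF \<kappa> N0[of 0]] N0[of 2] by simp
    finally show ?thesis unfolding HN row1 norm_mult power_mult_distrib P_def
      by (intro mult_left_mono) auto
  qed
  have "N k = 0"
  proof (rule isotropic_dominance[of N P m H])
    show "H 0 * N 0 \<le> P * (2 * N 0 + 2 * N 1)" using row0 by (simp only: HN) (simp add: P_def N_def)
    show "H (Suc k) * N (Suc k) \<le> P * (6 * N k + 2 * N (Suc (Suc k)))" for k
    proof (cases k)
      case 0
      then show ?thesis using r1 by (simp add: numeral_eq_Suc)
    next
      case (Suc j)
      have "P * (3 * N (j + 1) + 3/2 * N (j + 3)) \<le> P * (6 * N (j + 1) + 2 * N (j + 3))"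
        using P0 N0 by (intro mult_left_mono add_mono mult_right_mono) auto
      with r2(1)[of j] Suc show ?thesis by (simp add: numeral_eq_Suc)
    qed
    show "H (Suc k) * N (Suc k) \<le> P * (3/2 * N k + 3 * N (Suc (Suc k)))" if "m \<le> k" for k
    proof -
      have "k \<noteq> 0" using m that by simp
      then obtain j where "k = Suc j" by (cases k) auto
      with r2(2)[of j] show ?thesis by (simp add: numeral_eq_Suc)
    qed
    show "11/2 * P < H k" if "k = m + 1 \<or> k + 1 = m" for k
      using less_le_trans[OF \<delta>(2) power_mono[OF order_trans[OF near[OF that] re] \<delta>(1)]] by (simp add: H_def P_def)
    show "23/2 * P < H k" if "k \<noteq> m" "k \<noteq> m + 1" "k + 1 \<noteq> m" for k
      using less_le_trans[OF \<delta>(4) power_mono[OF order_trans[OF far[OF that] re] \<delta>(3)]] by (simp add: H_def P_def)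
    show "2 * N m \<le> suminf N" using isotropic_twice_le[OF summ iso, of m] by (simp add: N_def[abs_def])
  qed (use N0 summ P0 m in \<open>simp_all add: N_def[abs_def]\<close>)
  then show ?thesis by (simp add: N_def)
qed

lemma tail_zero:
  fixes x :: "nat \<Rightarrow> complex"
  assumes summ: "summable (\<lambda>k. (cmod (x k))\<^sup>2)"
    and tail: "(\<Sum>k. (cmod (x (k + 2)))\<^sup>2) \<le> t * (cmod (x 1))\<^sup>2" and x1: "x 1 = 0"
  shows "x (k + 2) = 0"
proof -
  have s: "summable (\<lambda>k. (cmod (x (k + 2)))\<^sup>2)" by (rule summable_ignore_initial_segment[OF summ])
  have "(\<Sum>k. (cmod (x (k + 2)))\<^sup>2) = 0"
    using tail x1 suminf_nonneg[OF s] by simp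
  then show ?thesis using suminf_eq_zero_iff[OF s] by simp
qed

lemma antiperiodic_half_line:
  fixes x :: "nat \<Rightarrow> complex" and q \<mu> s :: complex
  assumes q: "q \<noteq> 0" "(cmod q)\<^sup>2 \<le> 32/3" and s: "s = 1 \<or> s = - 1"
    and row0: "(\<mu> - 1) * x 0 = q * (s * x 0 + x 1)"
    and rows: "\<And>k. (\<mu> - of_real ((2 * real k + 3)\<^sup>2)) * x (k + 1) = q * (x k + x (k + 2))"
    and summ: "summable (\<lambda>k. (cmod (x k))\<^sup>2)" and iso: "(\<Sum>k. (x k)\<^sup>2) = 0"
  shows "x k = 0"
\<comment> \<open>17 is the midpoint of the second and third diagonal entries, 9 and 25.\<close>
proof (cases "Re \<mu> \<le> 17")
  case False
  \<comment> \<open>\<open>4 * m\<^sup>2 + 1\<close> is the midpoint of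
    \<open>(2 * m - 1)\<^sup>2\<close> and \<open>(2 * m + 1)\<^sup>2\<close>, so entry
    \<open>m\<close> is the one nearest to \<open>Re \<mu>\<close>. The adjacent entries are at
    distance at least \<open>4 * m\<close>, the others at least \<open>12 * m - 8\<close>;
    \<open>m = 2\<close> gives the 8 and 16 used below, and 11/2 * 32/3 < 64.\<close>
  obtain m where m: "m \<ge> 2" "4 * (real m)\<^sup>2 + 1 \<le> Re \<mu>" "Re \<mu> \<le> 4 * (real (Suc m))\<^sup>2 + 1"
  proof -
    have "real n \<le> 4 * (real n)\<^sup>2 + 1" for n
      using zero_le_power2[of "2 * real n - 1"] by (simp add: power2_eq_square algebra_simps)
    from ex_bracket[of "\<lambda>m. 4 * (real m)\<^sup>2 + 1", OF _ this, of "Re \<mu>"] False that show ?thesis by auto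
  qed
  define d where "d k = (2 * real k + 1)\<^sup>2" for k
  have dlow: "8 \<le> Re \<mu> - d k" if "k + 1 = m" for k
    using m that by (auto simp: d_def power2_eq_square algebra_simps)
  have dhigh: "8 \<le> d k - Re \<mu>" if "k = m + 1" for k
    using m that by (auto simp: d_def power2_eq_square algebra_simps)
  have dfarlow: "16 \<le> Re \<mu> - d k" if "k + 2 \<le> m" for k
  proof -
    have "d k \<le> (2 * real m - 3)\<^sup>2" unfolding d_def using that by (intro power_mono) auto
    then show ?thesis using m by (simp add: power2_eq_square algebra_simps)
  qed
  have dfarhigh: "16 \<le> d k - Re \<mu>" if "m + 2 \<le> k" for k
  proof -
    have "(2 * real m + 5)\<^sup>2 \<le> d k" unfolding d_def using that by (intro power_mono) auto
    then show ?thesis using m by (simp add: power2_eq_square algebra_simps)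
  qed
  show ?thesis
  proof (rule isotropic_jacobi_dominance[where d = d and \<mu> = \<mu> and q = q and \<kappa> = 1 and m = m and \<delta> = 8 and \<delta>' = 16])
    have s01: "(cmod (s * x 0 + x 1))\<^sup>2 \<le> 2 * (cmod (x 0))\<^sup>2 + 2 * (cmod (x 1))\<^sup>2"
    proof -
      have "cmod (s * x 0 + x 1) \<le> cmod (x 0) + cmod (x 1)"
        using s by (auto intro!: order_trans[OF norm_triangle_ineq] simp: norm_mult)
      then have "(cmod (s * x 0 + x 1))\<^sup>2 \<le> (cmod (x 0) + cmod (x 1))\<^sup>2" by (intro power_mono) auto
      also have "\<dots> \<le> 2 * (cmod (x 0))\<^sup>2 + 2 * (cmod (x 1))\<^sup>2"
        using sum_squares_bound[of "cmod (x 0)" "cmod (x 1)"] by (simp add: power2_sum)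
      finally show ?thesis .
    qed
    show "(cmod ((\<mu> - d 0) * x 0))\<^sup>2 \<le> (cmod q)\<^sup>2 * (2 * (cmod (x 0))\<^sup>2 + 2 * (cmod (x 1))\<^sup>2)"
      using row0 mult_left_mono[OF s01, of "(cmod q)\<^sup>2"] by (simp add: d_def norm_mult[of q] power_mult_distrib)
    show "(\<mu> - d 1) * x 1 = q * (1 * x 0 + x 2)" using rows[of 0] by (simp add: d_def numeral_eq_Suc)
    show "(\<mu> - d (k + 2)) * x (k + 2) = q * (x (k + 1) + x (k + 3))" for k
      using rows[of "k + 1"] by (simp add: d_def numeral_eq_Suc algebra_simps)
    show "8 \<le> \<bar>Re \<mu> - d k\<bar>" if "k = m + 1 \<or> k + 1 = m" for k
      using that dlow[of k] dhigh[of k] by auto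
    show "16 \<le> \<bar>Re \<mu> - d k\<bar>" if "k \<noteq> m" "k \<noteq> m + 1" "k + 1 \<noteq> m" for k
      using that dfarlow[of k] dfarhigh[of k] by (cases "k < m") auto
  qed (use q m summ iso in auto)
next
  case True
  \<comment> \<open>Rational upper bounds: 3.266 for the square root of 32/3; 0.1475 for the ratio
    \<open>s\<close> of \<open>jacobi_tail_bound\<close>, where the distance from row 3 on is at
    least 49 - 17 = 32; 0.482 for their product.\<close>
  have Q: "cmod q \<le> 3.266" by (rule power2_le_imp_le) (use q in \<open>auto simp: power2_eq_square\<close>)
  have sQ: "0.1475 * cmod q \<le> 0.482" using Q by simp
  define h where "h k = cmod (\<mu> - of_real ((2 * real k + 5)\<^sup>2))" for k
  have h: "(2 * real k + 5)\<^sup>2 - Re \<mu> \<le> h k" for k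
    using abs_Re_le_cmod[of "\<mu> - of_real ((2 * real k + 5)\<^sup>2)"] unfolding h_def by simp
  have h1: "32 \<le> h (Suc k)" for k
  proof -
    have "(7::real)\<^sup>2 \<le> (2 * real (Suc k) + 5)\<^sup>2" by (intro power_mono) auto
    with h[of "Suc k"] True show ?thesis by simp
  qed
  have h0: "h 0 = cmod (\<mu> - 25)" by (simp add: h_def)
  have hr: "h k * cmod (x (k + 2)) \<le> cmod q * (cmod (x (k + 1)) + cmod (x (k + 3)))" for k
  proof -
    have "h k * cmod (x (k + 2)) = cmod (q * (x (k + 1) + x (k + 3)))"
      using rows[of "k + 1"] by (simp add: h_def numeral_eq_Suc algebra_simps flip: norm_mult)
    also have "\<dots> \<le> cmod q * (cmod (x (k + 1)) + cmod (x (k + 3)))"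
      unfolding norm_mult by (intro mult_left_mono norm_triangle_ineq) auto
    finally show ?thesis .
  qed
  have tail: "cmod (x 2) \<le> r * cmod (x 1)"
    "(\<Sum>k. (cmod (x (k + 2)))\<^sup>2) \<le> r\<^sup>2 * (1 + 0.1475\<^sup>2) * (cmod (x 1))\<^sup>2"
    if "L \<le> cmod (\<mu> - 25)" "0.482 < L" "0 \<le> r" "3.266 \<le> r * (L - 0.482)" for L r
  proof -
    have "r * (L - 0.482) \<le> r * (L - 0.1475 * cmod q)" using sQ that by (intro mult_left_mono) auto
    then have "cmod q \<le> r * (L - 0.1475 * cmod q)" using Q that by linarith
    then show "cmod (x 2) \<le> r * cmod (x 1)"
      "(\<Sum>k. (cmod (x (k + 2)))\<^sup>2) \<le> r\<^sup>2 * (1 + 0.1475\<^sup>2) * (cmod (x 1))\<^sup>2"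
      using jacobi_tail_bound[of h x "cmod q" L 32 "0.1475" r, OF hr summ] h0 h1 that q sQ
      by (auto simp: power2_eq_square)
  qed
  have L0: "8 \<le> cmod (\<mu> - 25)" using h[of 0] h0 True by simp
  note t0 = tail[of 8 "0.435", OF L0]
  show ?thesis
  proof (cases "x 1 = 0")
    case x1: True
    have z: "x (k + 2) = 0" for k using tail_zero[OF summ t0(2) x1] by simp
    have "x 0 = 0" using rows[of 0] q x1 z[of 0] by simp
    with x1 z[of "k - 2"] show ?thesis by (cases k rule: nat.exhaust; cases "k - 1") (auto simp: numeral_eq_Suc)
  next
    case x1: False
    \<comment> \<open>Expressing \<open>x 2\<close> through its ratio to \<open>x 1\<close> closes
      rows 0 and 1 into a 2 x 2 system with second diagonal entry \<open>9 + \<rho>\<close>.\<close>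
    define \<rho> where "\<rho> = q * x 2 / x 1"
    have e1: "(\<mu> - 1 - s * q) * x 0 = q * x 1" using row0 by (simp add: algebra_simps)
    have e2: "(\<mu> - 9 - \<rho>) * x 1 = q * x 0" using rows[of 0] x1 by (simp add: \<rho>_def algebra_simps numeral_eq_Suc)
    have sq: "cmod (s * q) \<le> 3.266" using s Q by (auto simp: norm_mult)
    \<comment> \<open>One pass converts a lower bound \<open>L\<close> for the distance from
      \<open>\<mu>\<close> to 25 into a ratio \<open>r\<close>, a tail mass \<open>t\<close>, and a
      bound for \<open>2 * \<mu>\<close> minus the trace 1 + 9. \<open>u\<close> is a rational lower
      bound for \<open>sqrt (1 - t)\<close>.\<close>
    have pass: "(\<exists>w. 8 + \<rho> - s * q = q * w \<and> cmod (w\<^sup>2 + 4) \<le> t\<^sup>2 / (1 - t)) \<and>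
        cmod (2 * \<mu> - 10) \<le> 3.266 + 3.266 * r + 3.266 * (t / u) \<and> cmod \<rho> \<le> 3.266 * r"
      if L: "L \<le> cmod (\<mu> - 25)" "0.482 < L" "0 \<le> r" "3.266 \<le> r * (L - 0.482)"
        and t: "r\<^sup>2 * (1 + 0.1475\<^sup>2) \<le> t" "t < 1" and u: "0 < u" "u\<^sup>2 \<le> 1 - t" for L r t u
    proof -
      have "(\<Sum>k. (cmod (x (k + 2)))\<^sup>2) \<le> t * (cmod (x 1))\<^sup>2"
        using tail(2)[OF L] mult_right_mono[OF t(1), of "(cmod (x 1))\<^sup>2"] by simp
      then obtain \<tau> where \<tau>: "(x 0)\<^sup>2 + (1 + \<tau>) * (x 1)\<^sup>2 = 0" "cmod \<tau> \<le> t"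
        using isotropic_tail[OF summ iso _ x1] by blast
      have tn: "0 \<le> t" using t(1) by (meson order_trans zero_le_power2 mult_nonneg_nonneg add_nonneg_nonneg zero_le_one)
      have us: "u \<le> sqrt (1 - t)" using u by (intro real_le_rsqrt) auto
      note hd = isotropic_head[OF e1 e2 \<tau>(1) x1 \<tau>(2) t(2)]
      obtain w where w: "(\<mu> - 1 - s * q) - (\<mu> - 9 - \<rho>) = q * w" "cmod (w\<^sup>2 + 4) \<le> t\<^sup>2 / (1 - t)"
        using hd(1) by blast
      have \<rho>: "cmod \<rho> \<le> 3.266 * r"
      proof -
        have "cmod \<rho> \<le> cmod q * (r * cmod (x 1)) / cmod (x 1)"
          unfolding \<rho>_def norm_divide norm_mult using tail(1)[OF L] by (intro divide_right_mono mult_left_mono) auto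
        also have "\<dots> \<le> 3.266 * r" using x1 Q L(3) mult_right_mono[OF Q L(3)] by simp
        finally show ?thesis .
      qed
      have "cmod q * t / sqrt (1 - t) \<le> 3.266 * t / u"
        using Q tn us u by (intro frac_le mult_mono) auto
      then have "cmod ((\<mu> - 1 - s * q) + (\<mu> - 9 - \<rho>)) \<le> 3.266 * (t / u)" using hd(2) by simp
      moreover have "2 * \<mu> - 10 = ((\<mu> - 1 - s * q) + (\<mu> - 9 - \<rho>)) + s * q + \<rho>" by simp
      then have "cmod (2 * \<mu> - 10) \<le> cmod ((\<mu> - 1 - s * q) + (\<mu> - 9 - \<rho>)) + cmod (s * q) + cmod \<rho>"
        by (simp only: order_trans[OF norm_triangle_ineq add_mono[OF norm_triangle_ineq order_refl]])
      ultimately show ?thesis using w \<rho> sq by (auto simp: algebra_simps intro!: exI[of _ w])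
    qed
    have far: "20 - c \<le> cmod (\<mu> - 25)" if "cmod (2 * \<mu> - 10) \<le> 2 * c" for c
    proof -
      have "cmod (2 * (\<mu> - 5)) \<le> 2 * c" using that by (simp add: algebra_simps)
      then have "cmod (\<mu> - 5) \<le> c" by (simp only: norm_mult norm_numeral)
      with norm_triangle_ineq2[of 20 "\<mu> - 5"] show ?thesis by (simp add: norm_minus_commute)
    qed
    \<comment> \<open>Each pass moves \<open>\<mu>\<close> closer to 5, hence away from 25, which sharpens the next one.\<close>
    have "cmod (2 * \<mu> - 10) \<le> 2 * 2.7"
      using pass[OF L0, of "0.435" "0.194" "0.897"] by (simp add: power2_eq_square)
    from far[OF this] have L1: "17.3 \<le> cmod (\<mu> - 25)" by simp
    have "cmod (2 * \<mu> - 10) \<le> 2 * 2.02"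
      using pass[OF L1, of "0.1943" "0.0386" "0.98"] by (simp add: power2_eq_square)
    from far[OF this] have L2: "17.98 \<le> cmod (\<mu> - 25)" by simp
    from pass[OF L2, of "0.187" "0.036" "0.98"] obtain w where w: "8 + \<rho> - s * q = q * w"
      "cmod (w\<^sup>2 + 4) \<le> 0.036\<^sup>2 / (1 - 0.036)" and \<rho>: "cmod \<rho> \<le> 3.266 * 0.187"
      by (auto simp: power2_eq_square)
    have "cmod (w\<^sup>2 + 4) \<le> 0.00135" using w(2) by (simp add: power2_eq_square)
    from cmod_add_unit_le[OF this s] have "(cmod (w + s))\<^sup>2 \<le> 5.00135 + 2 * sqrt 0.00135" by simp
    also have "sqrt 0.00135 \<le> 0.0368" by (intro real_le_lsqrt) (auto simp: power2_eq_square)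
    finally have ws: "(cmod (w + s))\<^sup>2 \<le> 5.07495" by simp
    \<comment> \<open>The relation for \<open>w\<close> reads
      \<open>8 + \<rho> = q * (w + s)\<close>. The right side has squared modulus at most 54.14, the
      left side at least \<open>7.38\<^sup>2\<close>, about 54.46: a margin below one
      percent.\<close>
    have "(cmod (8 + \<rho>))\<^sup>2 = (cmod q)\<^sup>2 * (cmod (w + s))\<^sup>2"
      using w(1) by (simp add: norm_mult power_mult_distrib algebra_simps flip: norm_mult power_mult_distrib)
    also have "\<dots> \<le> 32/3 * 5.07495" using q ws by (intro mult_mono) auto
    finally have "(cmod (8 + \<rho>))\<^sup>2 \<le> 54.14" by simp
    moreover have "7.38 \<le> cmod (8 + \<rho>)" using norm_triangle_ineq4[of "8 + \<rho>" \<rho>] \<rho> by simp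
    then have "7.38\<^sup>2 \<le> (cmod (8 + \<rho>))\<^sup>2" by (intro power_mono) auto
    ultimately show ?thesis by (simp add: power2_eq_square)
  qed
qed


lemma periodic_half_line:
  fixes x :: "nat \<Rightarrow> complex" and q \<mu> :: complex
  assumes q: "q \<noteq> 0" "(cmod q)\<^sup>2 \<le> 16/9"
    and row0: "\<mu> * x 0 = of_real (sqrt 2) * q * x 1 \<or> x 0 = 0"
    and row1: "(\<mu> - 4) * x 1 = q * (of_real (sqrt 2) * x 0 + x 2)"
    and rows: "\<And>k. (\<mu> - of_real (4 * (real k + 2)\<^sup>2)) * x (k + 2) = q * (x (k + 1) + x (k + 3))"
    and summ: "summable (\<lambda>k. (cmod (x k))\<^sup>2)" and iso: "(\<Sum>k. (x k)\<^sup>2) = 0"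
  shows "x k = 0"
\<comment> \<open>10 is the midpoint of the diagonal entries 4 and 16.\<close>
proof (cases "Re \<mu> \<le> 10")
  case False
  \<comment> \<open>\<open>4 * m\<^sup>2 - 4 * m + 2\<close> is the midpoint of
    \<open>4 * (m - 1)\<^sup>2\<close> and \<open>4 * m\<^sup>2\<close>. Adjacent entries are at
    distance at least \<open>4 * m - 2\<close>, the others at least \<open>12 * m - 14\<close>;
    \<open>m = 2\<close> gives 6 and 10.\<close>
  obtain m where m: "m \<ge> 2" "4 * (real m)\<^sup>2 - 4 * real m + 2 \<le> Re \<mu>" "Re \<mu> \<le> 4 * (real m)\<^sup>2 + 4 * real m + 2"
  proof -
    have "real n \<le> 4 * (real n)\<^sup>2 - 4 * real n + 2" for n
      using zero_le_power2[of "2 * real n - 5/4"] by (simp add: power2_eq_square algebra_simps)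
    from ex_bracket[of "\<lambda>m. 4 * (real m)\<^sup>2 - 4 * real m + 2", OF _ this, of "Re \<mu>"] False that show ?thesis
      by (auto simp: power2_eq_square algebra_simps)
  qed
  define d where "d k = 4 * (real k)\<^sup>2" for k
  have dlow: "6 \<le> Re \<mu> - d k" if "k + 1 = m" for k
    using m that by (auto simp: d_def power2_eq_square algebra_simps)
  have dhigh: "6 \<le> d k - Re \<mu>" if "k = m + 1" for k
    using m that by (auto simp: d_def power2_eq_square algebra_simps)
  have dfarlow: "10 \<le> Re \<mu> - d k" if "k + 2 \<le> m" for k
  proof -
    have "d k \<le> 4 * (real m - 2)\<^sup>2" unfolding d_def using that by (intro mult_left_mono power_mono) auto
    then show ?thesis using m by (simp add: power2_eq_square algebra_simps)
  qed
  have dfarhigh: "10 \<le> d k - Re \<mu>" if "m + 2 \<le> k" for k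
  proof -
    have "4 * (real m + 2)\<^sup>2 \<le> d k" unfolding d_def using that by (intro mult_left_mono power_mono) auto
    then show ?thesis using m by (simp add: power2_eq_square algebra_simps)
  qed
  show ?thesis
  proof (rule isotropic_jacobi_dominance[where d = d and \<mu> = \<mu> and q = q and \<kappa> = "of_real (sqrt 2)" and m = m and \<delta> = 6 and \<delta>' = 10])
    show "(cmod ((\<mu> - d 0) * x 0))\<^sup>2 \<le> (cmod q)\<^sup>2 * (2 * (cmod (x 0))\<^sup>2 + 2 * (cmod (x 1))\<^sup>2)"
      using row0
    proof
      assume r: "\<mu> * x 0 = of_real (sqrt 2) * q * x 1"
      have "(\<mu> - d 0) * x 0 = of_real (sqrt 2) * q * x 1" using r by (simp add: d_def)
      then have "(cmod ((\<mu> - d 0) * x 0))\<^sup>2 = (cmod q)\<^sup>2 * (2 * (cmod (x 1))\<^sup>2)"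
        by (simp add: norm_mult power_mult_distrib)
      then show ?thesis by (simp add: mult_left_mono)
    qed simp
    show "(\<mu> - d 1) * x 1 = q * (of_real (sqrt 2) * x 0 + x 2)" using row1 by (simp add: d_def)
    show "(\<mu> - d (k + 2)) * x (k + 2) = q * (x (k + 1) + x (k + 3))" for k
      using rows[of k] by (simp add: d_def algebra_simps)
    show "6 \<le> \<bar>Re \<mu> - d k\<bar>" if "k = m + 1 \<or> k + 1 = m" for k
      using that dlow[of k] dhigh[of k] by auto
    show "10 \<le> \<bar>Re \<mu> - d k\<bar>" if "k \<noteq> m" "k \<noteq> m + 1" "k + 1 \<noteq> m" for k
      using that dfarlow[of k] dfarhigh[of k] by (cases "k < m") auto
  qed (use q m summ iso in \<open>auto simp: norm_of_real\<close>)
next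
  case True
  have Q: "cmod q \<le> 4/3" by (rule power2_le_imp_le) (use q in \<open>auto simp: power2_eq_square\<close>)
  have sQ: "0.0735 * cmod q \<le> 0.098" using Q by simp
  define h where "h k = cmod (\<mu> - of_real (4 * (real k + 2)\<^sup>2))" for k
  have h: "4 * (real k + 2)\<^sup>2 - Re \<mu> \<le> h k" for k
    using abs_Re_le_cmod[of "\<mu> - of_real (4 * (real k + 2)\<^sup>2)"] unfolding h_def by simp
  have h1: "26 \<le> h (Suc k)" for k
  proof -
    have "(3::real)\<^sup>2 \<le> (real (Suc k) + 2)\<^sup>2" by (intro power_mono) auto
    with h[of "Suc k"] True show ?thesis by simp
  qed
  have h0: "h 0 = cmod (\<mu> - 16)" by (simp add: h_def)
  have hr: "h k * cmod (x (k + 2)) \<le> cmod q * (cmod (x (k + 1)) + cmod (x (k + 3)))" for k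
  proof -
    have "h k * cmod (x (k + 2)) = cmod (q * (x (k + 1) + x (k + 3)))"
      unfolding rows[symmetric] h_def norm_mult ..
    also have "\<dots> \<le> cmod q * (cmod (x (k + 1)) + cmod (x (k + 3)))"
      unfolding norm_mult by (intro mult_left_mono norm_triangle_ineq) auto
    finally show ?thesis .
  qed
  have tail: "cmod (x 2) \<le> r * cmod (x 1)"
    "(\<Sum>k. (cmod (x (k + 2)))\<^sup>2) \<le> r\<^sup>2 * (1 + 0.0735\<^sup>2) * (cmod (x 1))\<^sup>2"
    if "L \<le> cmod (\<mu> - 16)" "0.098 < L" "0 \<le> r" "4/3 \<le> r * (L - 0.098)" for L r
  proof -
    have "r * (L - 0.098) \<le> r * (L - 0.0735 * cmod q)" using sQ that by (intro mult_left_mono) auto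
    then have "cmod q \<le> r * (L - 0.0735 * cmod q)" using Q that by linarith
    then show "cmod (x 2) \<le> r * cmod (x 1)"
      "(\<Sum>k. (cmod (x (k + 2)))\<^sup>2) \<le> r\<^sup>2 * (1 + 0.0735\<^sup>2) * (cmod (x 1))\<^sup>2"
      using jacobi_tail_bound[of h x "cmod q" L 26 "0.0735" r, OF hr summ] h0 h1 that q sQ
      by (auto simp: power2_eq_square)
  qed
  have L0: "6 \<le> cmod (\<mu> - 16)" using h[of 0] h0 True by simp
  note t0 = tail[of 6 "0.226", OF L0]
  show ?thesis
  proof (cases "x 1 = 0")
    case x1: True
    have z: "x (k + 2) = 0" for k using tail_zero[OF summ t0(2) x1] by simp
    have "x 0 = 0" using row1 q x1 z[of 0] by (simp add: numeral_eq_Suc)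
    with x1 z[of "k - 2"] show ?thesis by (cases k rule: nat.exhaust; cases "k - 1") (auto simp: numeral_eq_Suc)
  next
    case x1: False
    define \<rho> where "\<rho> = q * x 2 / x 1"
    define p where "p = of_real (sqrt 2) * q"
    have p2: "(cmod p)\<^sup>2 \<le> 32/9" using q by (simp add: p_def norm_mult power_mult_distrib)
    have p: "cmod p \<le> 1.886" by (rule power2_le_imp_le) (use p2 in \<open>auto simp: power2_eq_square\<close>)
    have e2: "(\<mu> - 4 - \<rho>) * x 1 = p * x 0" using row1 x1 by (simp add: \<rho>_def p_def algebra_simps)
    have tau: "\<exists>\<tau>. (x 0)\<^sup>2 + (1 + \<tau>) * (x 1)\<^sup>2 = 0 \<and> cmod \<tau> \<le> t"
      if L: "L \<le> cmod (\<mu> - 16)" "0.098 < L" "0 \<le> r" "4/3 \<le> r * (L - 0.098)"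
        and t: "r\<^sup>2 * (1 + 0.0735\<^sup>2) \<le> t" for L r t
    proof -
      have "(\<Sum>k. (cmod (x (k + 2)))\<^sup>2) \<le> t * (cmod (x 1))\<^sup>2"
        using tail(2)[OF L] mult_right_mono[OF t(1), of "(cmod (x 1))\<^sup>2"] by simp
      then show ?thesis using isotropic_tail[OF summ iso _ x1] by blast
    qed
    \<comment> \<open>This excludes odd solutions in this range: with \<open>x 0 = 0\<close>,
      isotropy would make the tail cancel \<open>(x 1)\<^sup>2\<close> alone, although it is at most
      0.0514 of it. Only the even form of row 0 remains.\<close>
    have "x 0 \<noteq> 0"
    proof
      assume "x 0 = 0"
      with tau[OF L0, of "0.226" "0.0514"] x1 obtain \<tau> where "1 + \<tau> = 0" "cmod \<tau> \<le> 0.0514"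
        by (auto simp: power2_eq_square)
      then show False by (auto simp: add_eq_0_iff)
    qed
    with row0 have e1: "\<mu> * x 0 = p * x 1" by (simp add: p_def)
    have pass: "(\<exists>w. 4 + \<rho> = p * w \<and> cmod (w\<^sup>2 + 4) \<le> t\<^sup>2 / (1 - t)) \<and>
        cmod (2 * \<mu> - 4) \<le> 4/3 * r + 1.886 * (t / u) \<and> cmod \<rho> \<le> 4/3 * r"
      if L: "L \<le> cmod (\<mu> - 16)" "0.098 < L" "0 \<le> r" "4/3 \<le> r * (L - 0.098)"
        and t: "r\<^sup>2 * (1 + 0.0735\<^sup>2) \<le> t" "t < 1" and u: "0 < u" "u\<^sup>2 \<le> 1 - t" for L r t u
    proof -
      obtain \<tau> where \<tau>: "(x 0)\<^sup>2 + (1 + \<tau>) * (x 1)\<^sup>2 = 0" "cmod \<tau> \<le> t"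
        using tau[OF L t(1)] by blast
      have tn: "0 \<le> t" using t(1) by (meson order_trans zero_le_power2 mult_nonneg_nonneg add_nonneg_nonneg zero_le_one)
      have us: "u \<le> sqrt (1 - t)" using u by (intro real_le_rsqrt) auto
      note hd = isotropic_head[OF e1 e2 \<tau>(1) x1 \<tau>(2) t(2)]
      obtain w where w: "\<mu> - (\<mu> - 4 - \<rho>) = p * w" "cmod (w\<^sup>2 + 4) \<le> t\<^sup>2 / (1 - t)"
        using hd(1) by blast
      have \<rho>: "cmod \<rho> \<le> 4/3 * r"
      proof -
        have "cmod \<rho> \<le> cmod q * (r * cmod (x 1)) / cmod (x 1)"
          unfolding \<rho>_def norm_divide norm_mult using tail(1)[OF L] by (intro divide_right_mono mult_left_mono) auto
        also have "\<dots> \<le> 4/3 * r" using x1 Q L(3) mult_right_mono[OF Q L(3)] by simp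
        finally show ?thesis .
      qed
      have "cmod p * t / sqrt (1 - t) \<le> 1.886 * t / u"
        using p tn us u by (intro frac_le mult_mono) auto
      then have "cmod (\<mu> + (\<mu> - 4 - \<rho>)) \<le> 1.886 * (t / u)" using hd(2) by simp
      moreover have "2 * \<mu> - 4 = (\<mu> + (\<mu> - 4 - \<rho>)) + \<rho>" by simp
      then have "cmod (2 * \<mu> - 4) \<le> cmod (\<mu> + (\<mu> - 4 - \<rho>)) + cmod \<rho>"
        by (simp only: norm_triangle_ineq)
      ultimately show ?thesis using w \<rho> by (auto simp: algebra_simps intro!: exI[of _ w])
    qed
    \<comment> \<open>The trace 0 + 4 places \<open>\<mu>\<close> near 2, at distance about 14 from
      the next entry 16, and a single localisation is enough.\<close>
    have "cmod (2 * \<mu> - 4) \<le> 2 * 0.201"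
      using pass[OF L0, of "0.226" "0.0514" "0.97"] by (simp add: power2_eq_square)
    then have "cmod (2 * (\<mu> - 2)) \<le> 2 * 0.201" by (simp add: algebra_simps)
    then have "cmod (\<mu> - 2) \<le> 0.201" by (simp only: norm_mult norm_numeral)
    with norm_triangle_ineq2[of 14 "\<mu> - 2"] have L1: "13.79 \<le> cmod (\<mu> - 16)" by (simp add: norm_minus_commute)
    from pass[OF L1, of "0.0974" "0.00954" "0.99"] obtain w where w: "4 + \<rho> = p * w"
      "cmod (w\<^sup>2 + 4) \<le> 0.00954\<^sup>2 / (1 - 0.00954)" and \<rho>: "cmod \<rho> \<le> 4/3 * 0.0974"
      by (auto simp: power2_eq_square)
    have "cmod (w\<^sup>2 + 4) \<le> 0.0001" using w(2) by (simp add: power2_eq_square)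
    with norm_triangle_ineq4[of "w\<^sup>2 + 4" 4] have ws: "(cmod w)\<^sup>2 \<le> 4.0001" by (simp add: norm_power)
    have "(cmod (4 + \<rho>))\<^sup>2 = (cmod p)\<^sup>2 * (cmod w)\<^sup>2"
      using w(1) by (simp add: norm_mult power_mult_distrib)
    also have "\<dots> \<le> 32/9 * 4.0001" using p2 ws by (intro mult_mono) auto
    finally have "(cmod (4 + \<rho>))\<^sup>2 \<le> 14.3" by simp
    moreover have "3.8 \<le> cmod (4 + \<rho>)" using norm_triangle_ineq4[of "4 + \<rho>" \<rho>] \<rho> by simp
    then have "3.8\<^sup>2 \<le> (cmod (4 + \<rho>))\<^sup>2" by (intro power_mono) auto
    ultimately show ?thesis by (simp add: power2_eq_square)
  qed
qed

section \<open>Integration by parts and completeness of exponentials\<close>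

lemma integrable_mult_continuous:
  fixes f g :: "real \<Rightarrow> complex"
  assumes f: "integrable (lebesgue_on {a..b}) f" and g: "continuous_on {a..b} g"
  shows "integrable (lebesgue_on {a..b}) (\<lambda>x. f x * g x)"
proof -
  obtain B where B: "\<And>x. x \<in> {a..b} \<Longrightarrow> norm (g x) \<le> B"
    using compact_imp_bounded[OF compact_continuous_image[OF g compact_Icc]] unfolding bounded_iff by blast
  have gm: "g \<in> borel_measurable (lebesgue_on {a..b})"
    by (intro continuous_imp_measurable_on_sets_lebesgue g) auto
  show ?thesis
  proof (rule Bochner_Integration.integrable_bound)
    show "integrable (lebesgue_on {a..b}) (\<lambda>x. B * norm (f x))" using f by auto
    show "(\<lambda>x. f x * g x) \<in> borel_measurable (lebesgue_on {a..b})" using f gm by measurable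
    show "AE x in lebesgue_on {a..b}. norm (f x * g x) \<le> norm (B * norm (f x))"
    proof (rule AE_I2)
      fix x assume "x \<in> space (lebesgue_on {a..b})"
      then have gB: "norm (g x) \<le> \<bar>B\<bar>" using B[of x] by (auto simp: space_restrict_space)
      then show "norm (f x * g x) \<le> norm (B * norm (f x))"

        using mult_left_mono[OF gB norm_ge_zero[of "f x"]] by (simp add: norm_mult abs_mult mult.commute)
    qed
  qed
qed

text \<open>On a uniform partition the increments add up to at most the mesh times the telescoping
  increment of \<open>H\<close>, and the mesh tends to 0. No pointwise derivative of
  \<open>F\<close> is involved.\<close>

lemma interval_function_zero:
  fixes F :: "real \<Rightarrow> complex" and H :: "real \<Rightarrow> real"
  assumes ab: "a \<le> b" and bound: "\<And>u v. a \<le> u \<Longrightarrow> u \<le> v \<Longrightarrow> v \<le> b \<Longrightarrow> norm (F v - F u) \<le> (v - u) * (H v - H u)"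
  shows "F b = F a"
proof -
  have le: "norm (F b - F a) \<le> (b - a) * (H b - H a) / real (Suc n)" for n
  proof -
    define p where "p i = a + real i * ((b - a) / real (Suc n))" for i
    have p0: "p 0 = a" and pn: "p (Suc n) = b" by (auto simp: p_def)
    have ps: "p (Suc i) - p i = (b - a) / real (Suc n)" for i
      unfolding p_def of_nat_Suc[of i] by (simp add: distrib_right add_divide_distrib del: of_nat_Suc)
    have step0: "0 \<le> (b - a) / real (Suc n)" using ab by (intro divide_nonneg_nonneg) auto
    have p: "a \<le> p i" "p i \<le> p (Suc i)" for i
      using step0 ps[of i] mult_nonneg_nonneg[of "real i", OF _ step0] by (simp_all add: p_def[of i] del: of_nat_Suc)
    have pb: "p (Suc i) \<le> b" if "i < Suc n" for i
    proof -
      have "real (Suc i) * ((b - a) / real (Suc n)) \<le> real (Suc n) * ((b - a) / real (Suc n))"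
        using that ab by (intro mult_right_mono) auto
      then show ?thesis by (simp add: p_def)
    qed
    have "F b - F a = (\<Sum>i<Suc n. F (p (Suc i)) - F (p i))"
      by (subst sum_lessThan_telescope) (simp add: p0 pn)
    also have "norm \<dots> \<le> (\<Sum>i<Suc n. (b - a) / real (Suc n) * (H (p (Suc i)) - H (p i)))"
    proof (rule order_trans[OF norm_sum sum_mono])
      fix i assume "i \<in> {..<Suc n}"
      then show "norm (F (p (Suc i)) - F (p i)) \<le> (b - a) / real (Suc n) * (H (p (Suc i)) - H (p i))"
        using bound[of "p i" "p (Suc i)"] p[of i] pb[of i] ps[of i] by auto
    qed
    also have "\<dots> = (b - a) / real (Suc n) * (H b - H a)"
      unfolding sum_distrib_left[symmetric] by (subst sum_lessThan_telescope) (simp add: p0 pn)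
    finally show ?thesis by simp
  qed
  have "(\<lambda>n. (b - a) * (H b - H a) / real (Suc n)) \<longlonglongrightarrow> 0"
    using LIMSEQ_Suc[OF lim_const_over_n] by simp
  from LIMSEQ_le_const[OF this, of "norm (F b - F a)"] le have "norm (F b - F a) \<le> 0" by blast
  then show ?thesis by simp
qed

text \<open>The primitive \<open>f\<close> need not be differentiable everywhere: the defect of the formula on
  \<open>{u..v}\<close> is bounded by \<open>v - u\<close> times the integral of \<open>\<bar>g\<bar>\<close> over \<open>{u..v}\<close>, and so vanishes.\<close>

lemma integral_by_parts_indefinite:
  fixes f g \<phi> \<phi>' :: "real \<Rightarrow> complex"
  assumes ab: "a \<le> b" and g: "integrable (lebesgue_on {a..b}) g"
    and fg: "\<And>x. x \<in> {a..b} \<Longrightarrow> (g has_integral (f x - f a)) {a..x}"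
    and \<phi>: "\<And>x. x \<in> {a..b} \<Longrightarrow> (\<phi> has_vector_derivative \<phi>' x) (at x within {a..b})"
    and \<phi>': "continuous_on {a..b} \<phi>'"
  shows "integral {a..b} (\<lambda>x. g x * \<phi> x) + integral {a..b} (\<lambda>x. f x * \<phi>' x) = f b * \<phi> b - f a * \<phi> a"
proof -
  have c\<phi>: "continuous_on {a..b} \<phi>"
    unfolding continuous_on_eq_continuous_within using has_vector_derivative_continuous[OF \<phi>] by blast
  have gi: "g integrable_on {a..b}" by (rule integrable_on_lebesgue_on[OF g]) auto
  have ng: "(\<lambda>x. norm (g x)) integrable_on {a..b}"
    by (rule integrable_on_lebesgue_on) (use g in auto)
  have sub: "h integrable_on {u..v}" if "h integrable_on {a..b}" "a \<le> u" "v \<le> b" for h :: "real \<Rightarrow> complex" and u v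
    by (rule integrable_on_subinterval[OF that(1)]) (use that in auto)
  have subr: "h integrable_on {u..v}" if "h integrable_on {a..b}" "a \<le> u" "v \<le> b" for h :: "real \<Rightarrow> real" and u v
    by (rule integrable_on_subinterval[OF that(1)]) (use that in auto)
  have f_eq: "f x = f a + integral {a..x} g" if "x \<in> {a..b}" for x
    using integral_unique[OF fg[OF that]] by simp
  have cf: "continuous_on {a..b} f"
    by (subst continuous_on_cong[OF refl f_eq]) (auto intro!: continuous_intros indefinite_integral_continuous_1 gi)
  have g\<phi>: "(\<lambda>x. g x * \<phi> x) integrable_on {a..b}"
    by (rule integrable_on_lebesgue_on[OF integrable_mult_continuous[OF g c\<phi>]]) auto
  have f\<phi>': "(\<lambda>x. f x * \<phi>' x) integrable_on {a..b}"
    by (intro integrable_continuous_real continuous_intros cf \<phi>')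
  have \<phi>'i: "\<phi>' integrable_on {a..b}" by (intro integrable_continuous_real \<phi>')
  obtain K where K: "\<And>x. x \<in> {a..b} \<Longrightarrow> norm (\<phi>' x) \<le> K" and K0: "K \<ge> 0"
  proof -
    obtain B where "\<And>x. x \<in> {a..b} \<Longrightarrow> norm (\<phi>' x) \<le> B"
      using compact_imp_bounded[OF compact_continuous_image[OF \<phi>' compact_Icc]] unfolding bounded_iff by blast
    then have "\<And>x. x \<in> {a..b} \<Longrightarrow> norm (\<phi>' x) \<le> \<bar>B\<bar>" by fastforce
    then show ?thesis using that[of "\<bar>B\<bar>"] by auto
  qed
  define F where "F x = integral {a..x} (\<lambda>x. g x * \<phi> x) + integral {a..x} (\<lambda>x. f x * \<phi>' x) - f x * \<phi> x" for x
  define H where "H x = 2 * K * integral {a..x} (\<lambda>x. norm (g x))" for x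
  have "norm (F v - F u) \<le> (v - u) * (H v - H u)" if uv: "a \<le> u" "u \<le> v" "v \<le> b" for u v
  proof -
    have dif: "integral {a..v} h - integral {a..u} h = integral {u..v} h" if "h integrable_on {a..b}" for h :: "real \<Rightarrow> complex"
      using Henstock_Kurzweil_Integration.integral_combine[where a = a and c = u and b = v and f = h] uv sub[OF that, where u = a and v = v]
      by (auto simp: eq_diff_eq diff_eq_eq add.commute)
    have difr: "integral {a..v} h - integral {a..u} h = integral {u..v} h" if "h integrable_on {a..b}" for h :: "real \<Rightarrow> real"
      using Henstock_Kurzweil_Integration.integral_combine[where a = a and c = u and b = v and f = h] uv subr[OF that, where u = a and v = v] by simp
    define J where "J = integral {u..v} (\<lambda>x. norm (g x))"
    have J0: "J \<ge> 0" unfolding J_def by (rule integral_nonneg[OF subr[OF ng]]) (use uv in auto)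
    have HJ: "H v - H u = 2 * K * J" unfolding H_def J_def difr[OF ng, symmetric] by (simp add: algebra_simps)
    have \<phi>_int: "(\<phi>' has_integral (\<phi> y - \<phi> x)) {x..y}" if "a \<le> x" "x \<le> y" "y \<le> b" for x y
    proof (rule fundamental_theorem_of_calculus[OF that(2)])
      fix t assume "t \<in> {x..y}"
      then show "(\<phi> has_vector_derivative \<phi>' t) (at t within {x..y})"
        using that by (intro has_vector_derivative_within_subset[OF \<phi>]) auto
    qed
    have \<phi>_lip: "norm (\<phi> x - \<phi> u) \<le> K * (v - u)" if "x \<in> {u..v}" for x
    proof -
      have "norm (\<phi> x - \<phi> u) \<le> K * (x - u)"
        using has_integral_bound_real[OF K0 finite.emptyI \<phi>_int[of u x]] that uv K by auto
      also have "\<dots> \<le> K * (v - u)" using that K0 by (intro mult_left_mono) auto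
      finally show ?thesis .
    qed
    have f_dif: "f v - f x = integral {x..v} g" if "x \<in> {u..v}" for x
      using Henstock_Kurzweil_Integration.integral_combine[where a = a and c = x and b = v and f = g] uv that sub[OF gi, where u = a and v = v] f_eq[of x] f_eq[of v]
      by (auto simp: diff_eq_eq add.commute)
    have f_lip: "norm (f x - f v) \<le> J" if "x \<in> {u..v}" for x
    proof -
      have "norm (f v - f x) \<le> integral {x..v} (\<lambda>x. norm (g x))"
        unfolding f_dif[OF that] by (rule integral_norm_bound_integral[OF sub[OF gi] subr[OF ng]]) (use that uv in auto)
      also have "\<dots> \<le> J" unfolding J_def
        by (rule integral_subset_le) (use that uv in \<open>auto intro!: subr[OF ng]\<close>)
      finally show ?thesis by (simp add: norm_minus_commute)
    qed
    have i1: "integral {u..v} (\<lambda>x. g x * (\<phi> x - \<phi> u)) = integral {u..v} (\<lambda>x. g x * \<phi> x) - (f v - f u) * \<phi> u"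
    proof -
      have "integral {u..v} (\<lambda>x. g x * \<phi> x - g x * \<phi> u) = integral {u..v} (\<lambda>x. g x * \<phi> x) - integral {u..v} (\<lambda>x. g x * \<phi> u)"
        by (rule integral_diff) (use uv in \<open>auto intro!: sub[OF g\<phi>] integrable_on_mult_left sub[OF gi]\<close>)
      also have "integral {u..v} (\<lambda>x. g x * \<phi> u) = (f v - f u) * \<phi> u" using f_dif[of u] uv by simp
      finally show ?thesis by (simp add: algebra_simps)
    qed
    have i2: "integral {u..v} (\<lambda>x. (f x - f v) * \<phi>' x) = integral {u..v} (\<lambda>x. f x * \<phi>' x) - f v * (\<phi> v - \<phi> u)"
    proof -
      have "integral {u..v} (\<lambda>x. f x * \<phi>' x - f v * \<phi>' x) = integral {u..v} (\<lambda>x. f x * \<phi>' x) - integral {u..v} (\<lambda>x. f v * \<phi>' x)"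
        by (rule integral_diff) (use uv in \<open>auto intro!: sub[OF f\<phi>'] integrable_on_mult_right sub[OF \<phi>'i]\<close>)
      also have "integral {u..v} (\<lambda>x. f v * \<phi>' x) = f v * (\<phi> v - \<phi> u)" using integral_unique[OF \<phi>_int[of u v]] uv by simp
      finally show ?thesis by (simp add: algebra_simps)
    qed
    \<comment> \<open>The constants are taken at opposite ends, \<open>\<phi> u\<close> and
      \<open>f v\<close>, so that the two corrections add up to exactly
      \<open>f v * \<phi> v - f u * \<phi> u\<close>.\<close>
    have F_dif: "F v - F u = integral {u..v} (\<lambda>x. g x * (\<phi> x - \<phi> u)) + integral {u..v} (\<lambda>x. (f x - f v) * \<phi>' x)"
      unfolding i1 i2 F_def using dif[OF g\<phi>] dif[OF f\<phi>'] by (simp add: algebra_simps)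
    have b1: "norm (integral {u..v} (\<lambda>x. g x * (\<phi> x - \<phi> u))) \<le> integral {u..v} (\<lambda>x. norm (g x) * (K * (v - u)))"
    proof (rule integral_norm_bound_integral)
      show "(\<lambda>x. g x * (\<phi> x - \<phi> u)) integrable_on {u..v}"
        unfolding right_diff_distrib by (rule integrable_diff) (use uv in \<open>auto intro!: sub[OF g\<phi>] integrable_on_mult_left sub[OF gi]\<close>)
      show "(\<lambda>x. norm (g x) * (K * (v - u))) integrable_on {u..v}"
        by (intro integrable_on_mult_left subr[OF ng] uv)
      show "norm (g x * (\<phi> x - \<phi> u)) \<le> norm (g x) * (K * (v - u))" if "x \<in> {u..v}" for x
        unfolding norm_mult by (intro mult_left_mono \<phi>_lip that) auto
    qed
    have b2: "norm (integral {u..v} (\<lambda>x. (f x - f v) * \<phi>' x)) \<le> integral {u..v} (\<lambda>x. J * K)"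
    proof (rule integral_norm_bound_integral)
      show "(\<lambda>x. (f x - f v) * \<phi>' x) integrable_on {u..v}"
        unfolding left_diff_distrib by (rule integrable_diff) (use uv in \<open>auto intro!: sub[OF f\<phi>'] integrable_on_mult_right sub[OF \<phi>'i]\<close>)
      show "norm ((f x - f v) * \<phi>' x) \<le> J * K" if "x \<in> {u..v}" for x
        unfolding norm_mult using uv that J0 by (intro mult_mono f_lip K) auto
    qed auto
    have "norm (F v - F u) \<le> J * (K * (v - u)) + (v - u) * (J * K)"
      unfolding F_dif using order_trans[OF norm_triangle_ineq add_mono[OF b1 b2]] uv by (simp add: J_def)
    then show ?thesis unfolding HJ by (simp add: algebra_simps)
  qed
  from interval_function_zero[OF ab this] have "F b = F a" .
  then show ?thesis by (simp add: F_def algebra_simps)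
qed

section \<open>Completeness of the exponentials by the Stone-Weierstrass theorem\<close>

definition wave :: "int \<Rightarrow> real \<Rightarrow> complex" where
  "wave k x = exp (- (\<i> * of_int k * of_real x))"

lemma wave_0 [simp]: "wave 0 x = 1" "wave k 0 = 1"
  by (simp_all add: wave_def)

lemma wave_add: "wave (j + k) x = wave j x * wave k x"
  unfolding wave_def exp_add[symmetric] by (simp add: algebra_simps)

lemma wave_has_vector_derivative:
  "(wave k has_vector_derivative - (\<i> * of_int k * wave k x)) (at x within S)"
  unfolding wave_def
  by (rule has_vector_derivative_real_field) (auto intro!: derivative_eq_intros)

lemma continuous_on_wave [continuous_intros]: "continuous_on S (wave k)"
  unfolding wave_def by (intro continuous_intros)

lemma cnj_wave: "cnj (wave k x) = wave (- k) x"
  by (simp add: wave_def exp_cnj)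

lemma norm_wave [simp]: "cmod (wave k x) = 1"
  by (simp add: wave_def)

lemma wave_pi: "wave (2 * n) pi = 1" "wave (2 * n + 1) pi = -1"
proof -
  have "wave (2 * n) pi = exp (2 * of_int (- n) * pi * \<i>)" by (simp add: wave_def algebra_simps)
  also have "\<dots> = 1" by (rule exp_integer_2pi) simp
  finally show *: "wave (2 * n) pi = 1" .
  have "wave 1 pi = -1" by (simp add: wave_def exp_minus)
  then show "wave (2 * n + 1) pi = -1" unfolding wave_add * by simp
qed

text \<open>\<open>wave (-2)\<close> winds the interval once around the unit circle and identifies
  only the end points; a function with equal end values therefore descends to the circle.\<close>

lemma wave_circle_eq:
  assumes "x \<in> {0..pi}" "x' \<in> {0..pi}" "wave (-2) x = wave (-2) x'"
  shows "x = x' \<or> {x, x'} = {0, pi}"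
proof -
  have "exp (\<i> * of_real (2 * x)) = exp (\<i> * of_real (2 * x'))"
    using assms(3) by (simp add: wave_def algebra_simps)
  then obtain n where n: "\<i> * of_real (2 * x) = \<i> * of_real (2 * x') + (of_int (2 * n) * pi) * \<i>"
    unfolding exp_eq by blast
  then have "Im (\<i> * of_real (2 * x)) = Im (\<i> * of_real (2 * x') + (of_int (2 * n) * pi) * \<i>)" by simp
  then have d: "x - x' = of_int n * pi" by simp
  have "\<bar>x - x'\<bar> \<le> 1 * pi" using assms(1,2) by (auto simp: abs_le_iff)
  then have "\<bar>real_of_int n\<bar> * pi \<le> 1 * pi" unfolding d abs_mult by simp
  then have "\<bar>n\<bar> \<le> 1" by (simp only: mult_le_cancel_right_pos[OF pi_gt_zero])
  then consider "n = 0" | "n = 1" | "n = -1" by linarith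
  then show ?thesis using d assms(1,2) by cases auto
qed

lemma continuous_on_polynomial_wave:
  assumes "real_polynomial_function g"
  shows "continuous_on S (\<lambda>x. complex_of_real (g (wave k x)))"
proof -
  have "continuous_on UNIV g"
    using continuous_real_polymonial_function[OF assms] by (simp add: continuous_on_eq_continuous_at)
  from continuous_on_of_real[OF continuous_on_compose2[OF this continuous_on_wave subset_UNIV]] show ?thesis .
qed

text \<open>Multiplication by a polynomial in \<open>wave (-2) x\<close> only mixes the even waves.
  The statement is kept for all \<open>y\<close> and \<open>n\<close> because the product case
  absorbs one factor into \<open>y\<close>, and the linear case shifts \<open>n\<close>.\<close>

lemma real_polynomial_wave_orthogonal:
  fixes y :: "real \<Rightarrow> complex" and g :: "complex \<Rightarrow> real"
  assumes "real_polynomial_function g"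
    and "continuous_on {0..pi} y" and "\<And>n. integral {0..pi} (\<lambda>x. y x * wave (2 * n) x) = 0"
  shows "integral {0..pi} (\<lambda>x. y x * of_real (g (wave (-2) x)) * wave (2 * n) x) = 0"
  using assms
proof (induction g arbitrary: y n)
  case (linear f)
  \<comment> \<open>Every real-linear functional on the plane has the form
    \<open>\<alpha> * w + \<beta> * cnj w\<close>; on the circle the two terms move \<open>n\<close>
    to \<open>n - 1\<close> and \<open>n + 1\<close>.\<close>
  define \<alpha> \<beta> where "\<alpha> = (of_real (f 1) - \<i> * of_real (f \<i>)) / 2" and "\<beta> = (of_real (f 1) + \<i> * of_real (f \<i>)) / 2"
  interpret f: bounded_linear f by fact
  have fw: "of_real (f w) = \<alpha> * w + \<beta> * cnj w" for w
  proof -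
    have "w = Re w *\<^sub>R 1 + Im w *\<^sub>R \<i>" by (simp add: complex_eq_iff)
    then have "f w = Re w * f 1 + Im w * f \<i>" by (metis f.add f.scaleR real_scaleR_def)
    then show ?thesis by (simp add: \<alpha>_def \<beta>_def complex_eq_iff field_simps)
  qed
  have i: "(\<lambda>x. y x * wave (2 * n) x) integrable_on {0..pi}" for n
    by (intro integrable_continuous_real continuous_intros linear)
  have eq: "(\<lambda>x. y x * of_real (f (wave (-2) x)) * wave (2 * n) x) =
      (\<lambda>x. \<alpha> * (y x * wave (2 * (n - 1)) x) + \<beta> * (y x * wave (2 * (n + 1)) x))"
    using wave_add[of "-2" "2 * n"] wave_add[of "2" "2 * n"]
    by (simp add: fw cnj_wave algebra_simps fun_eq_iff)
  show ?case
    unfolding eq integral_add[OF integrable_on_mult_right[OF i] integrable_on_mult_right[OF i]] integral_mult_right linear(3)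
    by simp
next
  case (const c)
  then show ?case by (simp add: mult.commute[of _ "of_real c"] mult.assoc)
next
  case (add f g)
  have eq: "(\<lambda>x. y x * of_real (f (wave (-2) x) + g (wave (-2) x)) * wave (2 * n) x) =
     (\<lambda>x. y x * of_real (f (wave (-2) x)) * wave (2 * n) x + y x * of_real (g (wave (-2) x)) * wave (2 * n) x)"
    by (simp add: algebra_simps)
  have i: "(\<lambda>x. y x * of_real (h (wave (-2) x)) * wave (2 * n) x) integrable_on {0..pi}"
    if "real_polynomial_function h" for h
    by (intro integrable_continuous_real continuous_on_mult continuous_on_polynomial_wave continuous_on_wave that add)
  show ?case
    unfolding eq integral_add[OF i[OF add(1)] i[OF add(2)]] add.IH(1)[OF add.prems] add.IH(2)[OF add.prems] by simp
next
  case (mult f g)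
  have "continuous_on {0..pi} (\<lambda>x. y x * of_real (f (wave (-2) x)))"
    by (intro continuous_on_mult continuous_on_polynomial_wave mult)
  from mult.IH(2)[OF this mult.IH(1)[OF mult.prems]] show ?case by (simp add: mult.assoc)
qed

lemma wave_complete:
  fixes y :: "real \<Rightarrow> complex"
  assumes y: "continuous_on {0..pi} y" and per: "y pi = y 0"
    and orth: "\<And>n. integral {0..pi} (\<lambda>x. y x * wave (2 * n) x) = 0" and x: "x \<in> {0..pi}"
  shows "y x = 0"
proof -
  define C where "C = wave (-2) ` {0..pi}"
  \<comment> \<open>\<open>y\<close> transported to the unit circle, where the Stone-Weierstrass theorem applies\<close>
  define F where "F w = y (SOME x. x \<in> {0..pi} \<and> wave (-2) x = w)" for w
  have F: "F (wave (-2) x) = y x" if "x \<in> {0..pi}" for x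
  proof -
    define x' where "x' = (SOME x'. x' \<in> {0..pi} \<and> wave (-2) x' = wave (-2) x)"
    have "x' \<in> {0..pi} \<and> wave (-2) x' = wave (-2) x" unfolding x'_def by (rule someI[of _ x]) (use that in auto)
    with wave_circle_eq[of x' x] that per have "y x' = y x" by (auto simp: doubleton_eq_iff)
    then show ?thesis by (simp add: F_def x'_def)
  qed
  have C: "compact C" unfolding C_def by (intro compact_continuous_image continuous_intros) auto
  \<comment> \<open>The circle carries the quotient topology of the interval: the preimage of a
    closed set under \<open>F\<close> is a continuous image of a compact set.\<close>
  have "closed (F -` B \<inter> C)" if "closed B" for B
  proof -
    have "compact ({0..pi} \<inter> y -` B)"
      using compact_Int_closed[OF compact_Icc continuous_closed_preimage[OF y closed_atLeastAtMost that], of 0 pi]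
      by (simp add: Int_assoc[symmetric])
    then have "compact (wave (-2) ` ({0..pi} \<inter> y -` B))"
      by (intro compact_continuous_image continuous_intros)
    moreover have "F -` B \<inter> C = wave (-2) ` ({0..pi} \<inter> y -` B)"
      by (auto simp: C_def F)
    ultimately show ?thesis by (simp add: compact_imp_closed)
  qed
  then have Fc: "continuous_on C F" using C by (simp add: continuous_on_closed_vimage compact_imp_closed)
  obtain B where B: "\<And>x. x \<in> {0..pi} \<Longrightarrow> norm (y x) \<le> B"
    using compact_imp_bounded[OF compact_continuous_image[OF y compact_Icc]] unfolding bounded_iff by blast
  have B0: "B \<ge> 0" using B[of 0] norm_ge_zero[of "y 0"] by (simp del: norm_ge_zero)
  have est: "cmod (integral {0..pi} (\<lambda>x. y x * cnj (y x))) \<le> e * (2 * B * pi)" if e: "e > 0" for e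
  proof -
    obtain g1 where g1: "real_polynomial_function g1" "\<And>w. w \<in> C \<Longrightarrow> \<bar>Re (F w) - g1 w\<bar> < e"
      using Stone_Weierstrass_real_polynomial_function[OF C continuous_on_Re[OF Fc] e] by blast
    obtain g2 where g2: "real_polynomial_function g2" "\<And>w. w \<in> C \<Longrightarrow> \<bar>Im (F w) - g2 w\<bar> < e"
      using Stone_Weierstrass_real_polynomial_function[OF C continuous_on_Im[OF Fc] e] by blast
    \<comment> \<open>\<open>h\<close> approximates the conjugate of \<open>y\<close> uniformly. As
      \<open>y\<close> is orthogonal to \<open>h\<close>, the integral of \<open>y * cnj y\<close>
      is no larger than the approximation error allows.\<close>
    define h where "h x = complex_of_real (g1 (wave (-2) x)) - \<i> * of_real (g2 (wave (-2) x))" for x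
    have hc: "continuous_on {0..pi} h" unfolding h_def
      by (intro continuous_on_diff continuous_on_mult continuous_on_const continuous_on_polynomial_wave g1 g2)
    have yc: "continuous_on {0..pi} (\<lambda>x. cnj (y x))" by (intro continuous_intros y)
    have z: "integral {0..pi} (\<lambda>x. y x * of_real (g (wave (-2) x))) = 0" if "real_polynomial_function g" for g
      using real_polynomial_wave_orthogonal[OF that y orth, of 0] by simp
    have i: "(\<lambda>x. y x * of_real (g (wave (-2) x))) integrable_on {0..pi}" if "real_polynomial_function g" for g
      by (intro integrable_continuous_real continuous_on_mult continuous_on_polynomial_wave y that)
    have "integral {0..pi} (\<lambda>x. y x * h x) =
        integral {0..pi} (\<lambda>x. y x * of_real (g1 (wave (-2) x)) - \<i> * (y x * of_real (g2 (wave (-2) x))))"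
      by (simp add: h_def algebra_simps)
    also have "\<dots> = 0"
      unfolding integral_diff[OF i[OF g1(1)] integrable_on_mult_right[OF i[OF g2(1)]]] integral_mult_right z[OF g1(1)] z[OF g2(1)]
      by simp
    finally have yh: "integral {0..pi} (\<lambda>x. y x * h x) = 0" .
    have "integral {0..pi} (\<lambda>x. y x * cnj (y x)) = integral {0..pi} (\<lambda>x. y x * (cnj (y x) - h x))"
      unfolding right_diff_distrib
      using integral_diff[OF integrable_continuous_real[OF continuous_on_mult[OF y yc]] integrable_continuous_real[OF continuous_on_mult[OF y hc]]]
      by (simp add: yh)
    also have "cmod \<dots> \<le> integral {0..pi} (\<lambda>x. B * (2 * e))"
    proof (rule integral_norm_bound_integral)
      show "(\<lambda>x. y x * (cnj (y x) - h x)) integrable_on {0..pi}"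
        by (intro integrable_continuous_real continuous_on_mult continuous_on_diff y yc hc)
      fix x assume x: "x \<in> {0..pi}"
      then have w: "wave (-2) x \<in> C" by (auto simp: C_def)
      have "cmod (cnj (y x) - h x) \<le> \<bar>Re (y x) - g1 (wave (-2) x)\<bar> + \<bar>Im (y x) - g2 (wave (-2) x)\<bar>"
        using cmod_le[of "cnj (y x) - h x"] by (simp add: h_def abs_minus_commute)
      also have "\<dots> \<le> 2 * e" using g1(2)[OF w] g2(2)[OF w] F[OF x] by simp
      finally show "cmod (y x * (cnj (y x) - h x)) \<le> B * (2 * e)"
        unfolding norm_mult using B[OF x] B0 by (intro mult_mono) auto
    qed auto
    finally show ?thesis by (simp add: algebra_simps)
  qed
  have "cmod (integral {0..pi} (\<lambda>x. y x * cnj (y x))) \<le> 0 + e" if "e > 0" for e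
  proof -
    \<comment> \<open>The added 1 keeps the divisor positive when \<open>B = 0\<close>.\<close>
    have "cmod (integral {0..pi} (\<lambda>x. y x * cnj (y x))) \<le> e / (2 * B * pi + 1) * (2 * B * pi)"
      using that B0 by (intro est) (auto intro!: divide_pos_pos add_nonneg_pos)
    also have "\<dots> = e * ((2 * B * pi) / (2 * B * pi + 1))" by simp
    also have "\<dots> \<le> e * 1"
    proof (intro mult_left_mono)
      have "d / (d + 1) \<le> 1" if "d \<ge> 0" for d :: real using that by (simp add: divide_le_eq_1)
      from this[of "2 * B * pi"] B0 show "(2 * B * pi) / (2 * B * pi + 1) \<le> 1" by simp
    qed (use that in simp)
    finally show ?thesis by simp
  qed
  then have "cmod (integral {0..pi} (\<lambda>x. y x * cnj (y x))) \<le> 0" by (rule field_le_epsilon)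
  then have "integral {0..pi} (\<lambda>x. y x * cnj (y x)) = 0" by simp
  moreover have "integral {0..pi} (\<lambda>x. y x * cnj (y x)) = of_real (integral {0..pi} (\<lambda>x. (cmod (y x))\<^sup>2))"
    unfolding complex_norm_square[symmetric]
    by (rule integral_unique[OF has_integral_of_real[OF integrable_integral]]) (intro integrable_continuous_real continuous_intros y)
  ultimately have "integral {0..pi} (\<lambda>x. (cmod (y x))\<^sup>2) = 0" by simp
  then have "(cmod (y x))\<^sup>2 = 0"
    using integral_eq_0_iff[OF continuous_on_power[OF continuous_on_norm[OF y]] pi_gt_zero, of 2] x by simp
  then show ?thesis by simp
qed

section \<open>Fourier coefficients on L2\<close>

lemma square_integrable_imp_integrable:
  assumes "square_integrable f"
  shows "integrable (lebesgue_on {0..pi}) f"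
proof (rule Bochner_Integration.integrable_bound)
  show "integrable (lebesgue_on {0..pi}) (\<lambda>x. 1 + (cmod (f x))\<^sup>2)"
    using assms by (auto simp: square_integrable_def)
  show "f \<in> borel_measurable (lebesgue_on {0..pi})" using assms by (auto simp: square_integrable_def)
  have "c \<le> 1 + c\<^sup>2" for c :: real
    using zero_le_power2[of "2 * c - 1"] by (simp add: power2_eq_square algebra_simps)
  then show "AE x in lebesgue_on {0..pi}. norm (f x) \<le> norm (1 + (cmod (f x))\<^sup>2)"
    by (auto simp: abs_of_nonneg)
qed

lemma square_integrable_continuous:
  assumes "continuous_on {0..pi} f"
  shows "square_integrable f"
  unfolding square_integrable_def
  by (intro conjI continuous_imp_measurable_on_sets_lebesgue continuous_imp_integrable_real
      continuous_on_power continuous_on_norm assms) auto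

text \<open>Left unnormalised, since only homogeneous linear relations between the coefficients
  matter. Even \<open>k\<close> serve the periodic, odd \<open>k\<close> the antiperiodic
  problem.\<close>

lift_definition fourier :: "int \<Rightarrow> l2 \<Rightarrow> complex" is
  "\<lambda>k f. integral\<^sup>L (lebesgue_on {0..pi}) (\<lambda>x. f x * wave k x)"
proof -
  fix k f g
  assume fg: "l2_eq f g"
  have w: "wave k \<in> borel_measurable (lebesgue_on {0..pi})"
    by (intro continuous_imp_measurable_on_sets_lebesgue continuous_on_wave) auto
  have "f \<in> borel_measurable (lebesgue_on {0..pi})" "g \<in> borel_measurable (lebesgue_on {0..pi})"
    using fg by (auto simp: l2_eq_def square_integrable_def)
  with fg w show "integral\<^sup>L (lebesgue_on {0..pi}) (\<lambda>x. f x * wave k x) =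
      integral\<^sup>L (lebesgue_on {0..pi}) (\<lambda>x. g x * wave k x)"
    by (intro integral_cong_AE) (auto simp: l2_eq_def)
qed

lemma integrable_mult_wave:
  "square_integrable f \<Longrightarrow> integrable (lebesgue_on {0..pi}) (\<lambda>x. f x * wave k x)"
  by (intro integrable_mult_continuous square_integrable_imp_integrable continuous_on_wave)

lemma fourier_add: "fourier k (u + v) = fourier k u + fourier k v"
  by transfer (simp add: l2_eq_def distrib_right integrable_mult_wave)

lemma fourier_scale: "fourier k (scale_l2 c u) = c * fourier k u"
  by transfer (simp add: l2_eq_def mult.assoc)

lemma fourier_bounded: "\<exists>M. \<forall>k. cmod (fourier k u) \<le> M"
proof transfer
  fix f assume "l2_eq f f"
  then have f: "integrable (lebesgue_on {0..pi}) (\<lambda>x. f x * wave k x)" for k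
    by (simp add: l2_eq_def integrable_mult_wave)
  have "cmod (integral\<^sup>L (lebesgue_on {0..pi}) (\<lambda>x. f x * wave k x)) \<le> integral\<^sup>L (lebesgue_on {0..pi}) (\<lambda>x. cmod (f x))" for k
    using integral_norm_bound[of "lebesgue_on {0..pi}" "\<lambda>x. f x * wave k x"] by (simp add: norm_mult)
  then show "\<exists>M. \<forall>k. cmod (integral\<^sup>L (lebesgue_on {0..pi}) (\<lambda>x. f x * wave k x)) \<le> M" by blast
qed

lemma fourier_abs:
  assumes "square_integrable f"
  shows "fourier k (abs_l2 f) = integral {0..pi} (\<lambda>x. f x * wave k x)"
proof -
  have "l2_eq f f" using assms by (simp add: l2_eq_def)
  then show ?thesis
    using lebesgue_integral_eq_integral[OF integrable_mult_wave[OF assms]] by (simp add: fourier.abs_eq)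
qed

lemma abs_l2_add: "square_integrable f \<Longrightarrow> square_integrable g \<Longrightarrow> abs_l2 f + abs_l2 g = abs_l2 (\<lambda>x. f x + g x)"
  by (rule plus_l2.abs_eq) (simp_all add: l2_eq_def)

lemma abs_l2_scale: "square_integrable f \<Longrightarrow> scale_l2 c (abs_l2 f) = abs_l2 (\<lambda>x. c * f x)"
  by (rule scale_l2.abs_eq) (simp add: l2_eq_def)

lemma abs_l2_cong:
  assumes "square_integrable f" "square_integrable g" "\<And>x. x \<in> {0..pi} \<Longrightarrow> f x = g x"
  shows "abs_l2 f = abs_l2 g"
  by (rule Quotient_rel_abs[OF Quotient_l2]) (use assms in \<open>auto simp: l2_eq_def intro!: AE_I2\<close>)

lemma sobolev2_continuous:
  assumes "sobolev2 y y1 y2"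
  shows "continuous_on {0..pi} y" "continuous_on {0..pi} y1"
proof -
  show "continuous_on {0..pi} y"
    using assms unfolding sobolev2_def continuous_on_eq_continuous_within
    by (blast intro: has_vector_derivative_continuous)
  have "y2 integrable_on {0..pi}"
    using assms by (auto simp: sobolev2_def intro!: integrable_on_lebesgue_on square_integrable_imp_integrable)
  then have "continuous_on {0..pi} (\<lambda>x. y1 0 + integral {0..x} y2)"
    by (intro continuous_on_add continuous_on_const indefinite_integral_continuous_1)
  moreover have "y1 0 + integral {0..x} y2 = y1 x" if "x \<in> {0..pi}" for x
    using assms integral_unique[of y2 "y1 x - y1 0" "{0..x}"] that by (auto simp: sobolev2_def)
  ultimately show "continuous_on {0..pi} y1" by (rule continuous_on_eq)
qed

lemma potential_wave: "potential a b x = a * wave 2 x + b * wave (-2) x"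
  by (simp add: potential_def wave_def)

lemma sobolev2_square_integrable:
  assumes "sobolev2 y y1 y2"
  shows "square_integrable y" "square_integrable y2" "square_integrable (\<lambda>x. - y2 x + potential a b x * y x)"
proof -
  show y: "square_integrable y" by (rule square_integrable_continuous[OF sobolev2_continuous(1)[OF assms]])
  show y2: "square_integrable y2" using assms by (simp add: sobolev2_def)
  have "square_integrable (\<lambda>x. potential a b x * y x)" unfolding potential_wave
    by (intro square_integrable_continuous continuous_on_add continuous_on_mult continuous_on_const
        continuous_on_wave sobolev2_continuous(1)[OF assms])
  from square_integrable_add[OF square_integrable_scale[OF y2, of "-1"] this]
  show "square_integrable (\<lambda>x. - y2 x + potential a b x * y x)" by simp
qed

lemma sobolev2_add_scale:
  assumes "sobolev2 y y1 y2" "sobolev2 z z1 z2"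
  shows "sobolev2 (\<lambda>x. y x + c * z x) (\<lambda>x. y1 x + c * z1 x) (\<lambda>x. y2 x + c * z2 x)"
  unfolding sobolev2_def
proof (intro conjI ballI)
  fix x assume x: "x \<in> {0..pi}"
  show "((\<lambda>x. y x + c * z x) has_vector_derivative y1 x + c * z1 x) (at x within {0..pi})"
    using assms x unfolding sobolev2_def
    by (intro has_vector_derivative_add has_vector_derivative_mult_right) auto
  have "((\<lambda>x. y2 x + c * z2 x) has_integral (y1 x - y1 0) + c * (z1 x - z1 0)) {0..x}"
    using assms x unfolding sobolev2_def by (intro has_integral_add has_integral_mult_right) auto
  then show "((\<lambda>x. y2 x + c * z2 x) has_integral y1 x + c * z1 x - (y1 0 + c * z1 0)) {0..x}"
    by (simp add: algebra_simps)
qed (use assms in \<open>auto simp: sobolev2_def intro!: square_integrable_add square_integrable_scale\<close>)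

text \<open>Two integrations by parts; \<open>wave k pi * \<theta> = 1\<close> makes the boundary
  terms cancel each time. The second uses \<open>y1\<close> merely as an indefinite integral of
  \<open>y2\<close>.\<close>

lemma fourier_second_derivative:
  assumes y: "sobolev2 y y1 y2" and bc: "y pi = \<theta> * y 0" "y1 pi = \<theta> * y1 0" and k: "wave k pi * \<theta> = 1"
  shows "integral {0..pi} (\<lambda>x. y2 x * wave k x) = - (of_int k)\<^sup>2 * integral {0..pi} (\<lambda>x. y x * wave k x)"
proof -
  define w' where "w' x = - (\<i> * of_int k * wave k x)" for x
  have w': "continuous_on {0..pi} w'" unfolding w'_def by (intro continuous_intros)
  have y1i: "integrable (lebesgue_on {0..pi}) y1"
    by (rule continuous_imp_integrable_real[OF sobolev2_continuous(2)[OF y]])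
  have "(y1 has_integral (y x - y 0)) {0..x}" if "x \<in> {0..pi}" for x
  proof (rule fundamental_theorem_of_calculus)
    fix t assume t: "t \<in> {0..x}"
    have "(y has_vector_derivative y1 t) (at t within {0..pi})" using t that y by (auto simp: sobolev2_def)
    then show "(y has_vector_derivative y1 t) (at t within {0..x})"
      by (rule has_vector_derivative_within_subset) (use that in auto)
  qed (use that in auto)
  from integral_by_parts_indefinite[OF _ y1i this wave_has_vector_derivative[of k, folded w'_def] w']
  have "integral {0..pi} (\<lambda>x. y1 x * wave k x) + integral {0..pi} (\<lambda>x. y x * w' x) = y pi * wave k pi - y 0 * wave k 0"
    by simp
  also have "\<dots> = 0" using k bc by (simp add: ac_simps)
  also have "integral {0..pi} (\<lambda>x. y x * w' x) = - (\<i> * of_int k) * integral {0..pi} (\<lambda>x. y x * wave k x)"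
    unfolding w'_def integral_mult_right[symmetric] by (simp add: algebra_simps)
  finally have 1: "integral {0..pi} (\<lambda>x. y1 x * wave k x) = \<i> * of_int k * integral {0..pi} (\<lambda>x. y x * wave k x)"
    by simp
  have "(y2 has_integral (y1 x - y1 0)) {0..x}" if "x \<in> {0..pi}" for x
    using that y by (auto simp: sobolev2_def)
  from integral_by_parts_indefinite[OF _ square_integrable_imp_integrable this wave_has_vector_derivative[of k, folded w'_def] w'] y
  have "integral {0..pi} (\<lambda>x. y2 x * wave k x) + integral {0..pi} (\<lambda>x. y1 x * w' x) = y1 pi * wave k pi - y1 0 * wave k 0"
    by (simp add: sobolev2_def)
  also have "\<dots> = 0" using k bc by (simp add: ac_simps)
  also have "integral {0..pi} (\<lambda>x. y1 x * w' x) = - (\<i> * of_int k) * integral {0..pi} (\<lambda>x. y1 x * wave k x)"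
    unfolding w'_def integral_mult_right[symmetric] by (simp add: algebra_simps)
  finally have "integral {0..pi} (\<lambda>x. y2 x * wave k x) =
      \<i> * of_int k * (\<i> * of_int k * integral {0..pi} (\<lambda>x. y x * wave k x))" unfolding 1 by simp
  also have "\<dots> = (\<i> * \<i>) * (of_int k * of_int k) * integral {0..pi} (\<lambda>x. y x * wave k x)"
    by (simp only: ac_simps)
  finally show ?thesis by (simp add: power2_eq_square)
qed

section \<open>The operators in terms of Fourier coefficients\<close>

definition hill_op :: "complex \<Rightarrow> complex \<Rightarrow> complex \<Rightarrow> (l2 \<times> l2) set" where
  "hill_op \<theta> a b = {(abs_l2 y, abs_l2 (\<lambda>x. - y2 x + potential a b x * y x)) | y y1 y2.
     sobolev2 y y1 y2 \<and> y pi = \<theta> * y 0 \<and> y1 pi = \<theta> * y1 0}"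

lemma op_P_hill: "op_P a b = hill_op 1 a b" and op_A_hill: "op_A a b = hill_op (-1) a b"
  by (simp_all add: op_P_def op_A_def hill_op_def)

lemma hill_opI:
  assumes "sobolev2 y y1 y2" "y pi = \<theta> * y 0" "y1 pi = \<theta> * y1 0"
  shows "(abs_l2 y, abs_l2 (\<lambda>x. - y2 x + potential a b x * y x)) \<in> hill_op \<theta> a b"
proof -
  have "\<exists>z z1 z2. (abs_l2 y, abs_l2 (\<lambda>x. - y2 x + potential a b x * y x)) =
      (abs_l2 z, abs_l2 (\<lambda>x. - z2 x + potential a b x * z x)) \<and>
      sobolev2 z z1 z2 \<and> z pi = \<theta> * z 0 \<and> z1 pi = \<theta> * z1 0"
    using assms by (rule_tac exI[of _ y], rule_tac exI[of _ y1], rule_tac exI[of _ y2]) simp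
  then show ?thesis unfolding hill_op_def mem_Collect_eq .
qed

lemma hill_opE:
  assumes "(u, v) \<in> hill_op \<theta> a b"
  obtains y y1 y2 where "sobolev2 y y1 y2" "y pi = \<theta> * y 0" "y1 pi = \<theta> * y1 0"
    "u = abs_l2 y" "v = abs_l2 (\<lambda>x. - y2 x + potential a b x * y x)"
  using assms unfolding hill_op_def mem_Collect_eq prod.inject by (elim exE conjE) (rule that)

lemma hill_op_add_scale:
  assumes "(u, v) \<in> hill_op \<theta> a b" "(u', v') \<in> hill_op \<theta> a b"
  shows "(u + scale_l2 c u', v + scale_l2 c v') \<in> hill_op \<theta> a b"
proof -
  obtain y y1 y2 where y: "sobolev2 y y1 y2" "y pi = \<theta> * y 0" "y1 pi = \<theta> * y1 0"
    "u = abs_l2 y" "v = abs_l2 (\<lambda>x. - y2 x + potential a b x * y x)"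
    using hill_opE[OF assms(1)] .
  obtain z z1 z2 where z: "sobolev2 z z1 z2" "z pi = \<theta> * z 0" "z1 pi = \<theta> * z1 0"
    "u' = abs_l2 z" "v' = abs_l2 (\<lambda>x. - z2 x + potential a b x * z x)"
    using hill_opE[OF assms(2)] .
  note si = sobolev2_square_integrable
  have u: "u + scale_l2 c u' = abs_l2 (\<lambda>x. y x + c * z x)"
    using si[OF y(1)] si[OF z(1)] by (simp add: y z abs_l2_scale abs_l2_add square_integrable_scale)
  have "v + scale_l2 c v' = abs_l2 (\<lambda>x. (- y2 x + potential a b x * y x) + c * (- z2 x + potential a b x * z x))"
    using si[OF y(1)] si[OF z(1)] by (simp add: y z abs_l2_scale abs_l2_add square_integrable_scale)
  also have "(\<lambda>x. (- y2 x + potential a b x * y x) + c * (- z2 x + potential a b x * z x)) =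
      (\<lambda>x. - (y2 x + c * z2 x) + potential a b x * (y x + c * z x))"
    by (simp add: algebra_simps)
  finally have v: "v + scale_l2 c v' = abs_l2 (\<lambda>x. - (y2 x + c * z2 x) + potential a b x * (y x + c * z x))" .
  have bc: "y pi + c * z pi = \<theta> * (y 0 + c * z 0)" "y1 pi + c * z1 pi = \<theta> * (y1 0 + c * z1 0)"
    by (simp_all add: y(2,3) z(2,3) algebra_simps)
  show ?thesis
    unfolding u v by (rule hill_opI[OF sobolev2_add_scale[OF y(1) z(1)] bc])
qed

lemma hill_op_fourier:
  assumes "(u, v) \<in> hill_op \<theta> a b" and k: "wave k pi * \<theta> = 1"
  shows "fourier k v = (of_int k)\<^sup>2 * fourier k u + a * fourier (k + 2) u + b * fourier (k - 2) u"
proof -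
  obtain y y1 y2 where y: "sobolev2 y y1 y2" "y pi = \<theta> * y 0" "y1 pi = \<theta> * y1 0"
    "u = abs_l2 y" "v = abs_l2 (\<lambda>x. - y2 x + potential a b x * y x)"
    using hill_opE[OF assms(1)] .
  note si = sobolev2_square_integrable[OF y(1)]
  have i: "(\<lambda>x. f x * wave j x) integrable_on {0..pi}" if "square_integrable f" for f j
    by (rule integrable_on_lebesgue_on[OF integrable_mult_wave[OF that]]) auto
  have w: "wave (k + 2) x = wave 2 x * wave k x" "wave (k - 2) x = wave (-2) x * wave k x" for x
    using wave_add[of "-2" k x] by (simp_all add: wave_add)
  have eq: "(\<lambda>x. (- y2 x + potential a b x * y x) * wave k x) =
     (\<lambda>x. - (y2 x * wave k x) + (a * (y x * wave (k + 2) x) + b * (y x * wave (k - 2) x)))"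
    unfolding potential_wave w by (rule ext) algebra
  have "fourier k v = - integral {0..pi} (\<lambda>x. y2 x * wave k x) +
      (a * integral {0..pi} (\<lambda>x. y x * wave (k + 2) x) + b * integral {0..pi} (\<lambda>x. y x * wave (k - 2) x))"
    unfolding y(5) fourier_abs[OF si(3)] eq
      integral_add[OF integrable_neg[OF i[OF si(2)]] integrable_add[OF integrable_on_mult_right[OF i[OF si(1)]] integrable_on_mult_right[OF i[OF si(1)]]]]
      integral_add[OF integrable_on_mult_right[OF i[OF si(1)]] integrable_on_mult_right[OF i[OF si(1)]]]
    by simp
  then show ?thesis
    unfolding y(4) fourier_abs[OF si(1)] fourier_second_derivative[OF y(1-3) k] by simp
qed

text \<open>Multiplying the continuous representative by \<open>wave \<epsilon>\<close> makes it
  periodic also in the antiperiodic case and turns the indices \<open>2 * n + \<epsilon>\<close>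
  into even ones, as \<open>wave_complete\<close> requires.\<close>

lemma hill_op_fourier_complete:
  assumes "(u, v) \<in> hill_op \<theta> a b" and \<epsilon>: "wave \<epsilon> pi * \<theta> = 1" and z: "\<And>n. fourier (2 * n + \<epsilon>) u = 0"
  shows "u = 0"
proof -
  obtain y y1 y2 where y: "sobolev2 y y1 y2" "y pi = \<theta> * y 0" "u = abs_l2 y"
    using hill_opE[OF assms(1)] by metis
  note si = sobolev2_square_integrable[OF y(1)]
  have "y x * wave \<epsilon> x = 0" if "x \<in> {0..pi}" for x
  proof (rule wave_complete[OF _ _ _ that])
    show "continuous_on {0..pi} (\<lambda>x. y x * wave \<epsilon> x)"
      by (intro continuous_intros sobolev2_continuous(1)[OF y(1)])
    show "y pi * wave \<epsilon> pi = y 0 * wave \<epsilon> 0" using \<epsilon> y(2) by (simp add: ac_simps)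
    show "integral {0..pi} (\<lambda>x. y x * wave \<epsilon> x * wave (2 * n) x) = 0" for n
      using z[of n] unfolding y(3) fourier_abs[OF si(1)] by (simp add: add.commute[of _ \<epsilon>] wave_add mult.assoc)
  qed
  then have "y x = 0" if "x \<in> {0..pi}" for x using that by (simp add: wave_def)
  then show ?thesis unfolding y(3) zero_l2_def
    by (intro abs_l2_cong si square_integrable_zero) auto
qed

section \<open>Symmetry and associated functions\<close>

definition hill_diag :: "int \<Rightarrow> int \<Rightarrow> complex" where
  "hill_diag \<epsilon> n = (of_int (2 * n + \<epsilon>))\<^sup>2"

text \<open>The reflection \<open>n \<mapsto> - n - \<epsilon>\<close> negates the frequency
  \<open>2 * n + \<epsilon>\<close>. It fixes 0 for \<open>\<epsilon> = 0\<close> and nothing for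
  \<open>\<epsilon> = 1\<close>, which is why row 0 of the half-line problems differs.\<close>

lemma hill_diag_reflect: "hill_diag \<epsilon> (- n - \<epsilon>) = hill_diag \<epsilon> n"
  by (simp add: hill_diag_def power2_eq_square algebra_simps)

lemma diag_unbounded_hill:
  assumes "\<epsilon> = 0 \<or> \<epsilon> = 1"
  shows "diag_unbounded (hill_diag \<epsilon>)"
proof -
  have sq: "\<bar>n\<bar> \<le> (2 * n + \<epsilon>)\<^sup>2" for n
  proof -
    have "\<bar>n\<bar> \<le> \<bar>2 * n + \<epsilon>\<bar>" using assms by auto
    also have "\<dots> \<le> \<bar>2 * n + \<epsilon>\<bar> * \<bar>2 * n + \<epsilon>\<bar>"
      by (cases "2 * n + \<epsilon> = 0") (auto intro: mult_left_mono[of 1 "\<bar>2 * n + \<epsilon>\<bar>" "\<bar>2 * n + \<epsilon>\<bar>", simplified])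
    finally show ?thesis by (simp add: power2_eq_square)
  qed
  have le: "of_int \<bar>n\<bar> - cmod \<mu> \<le> cmod (\<mu> - hill_diag \<epsilon> n)" for n \<mu>
  proof -
    have "real_of_int \<bar>n\<bar> \<le> of_int ((2 * n + \<epsilon>)\<^sup>2)" using sq[of n] by (simp only: of_int_le_iff)
    also have "\<dots> = cmod (hill_diag \<epsilon> n)"
      unfolding hill_diag_def norm_power norm_of_int by simp
    finally show ?thesis using norm_triangle_ineq2[of "hill_diag \<epsilon> n" \<mu>] by (simp add: norm_minus_commute)
  qed
  have l: "filterlim (\<lambda>n. real n - cmod \<mu>) at_top sequentially" for \<mu>
    using filterlim_tendsto_add_at_top[OF tendsto_const[of "- cmod \<mu>"] filterlim_real_sequentially] by simp
  show ?thesis unfolding diag_unbounded_def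
    using le[of "int _"] le[of "- int _"]
    by (intro allI conjI filterlim_at_top_mono[OF l] always_eventually) auto
qed

lemma jacobi_solution_reflect:
  assumes "jacobi_solution (hill_diag \<epsilon>) q \<mu> c"
  shows "jacobi_solution (hill_diag \<epsilon>) q \<mu> (\<lambda>n. c (- n - \<epsilon>))"
  unfolding jacobi_solution_def
proof
  fix n
  have "(\<mu> - hill_diag \<epsilon> (- n - \<epsilon>)) * c (- n - \<epsilon>) = q * (c (- n - \<epsilon> + 1) + c (- n - \<epsilon> - 1))"
    using assms by (auto simp: jacobi_solution_def)
  moreover have "- n - \<epsilon> + 1 = - (n - 1) - \<epsilon>" "- n - \<epsilon> - 1 = - (n + 1) - \<epsilon>" by simp_all
  ultimately show "(\<mu> - hill_diag \<epsilon> n) * c (- n - \<epsilon>) = q * (c (- (n + 1) - \<epsilon>) + c (- (n - 1) - \<epsilon>))"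
    unfolding hill_diag_reflect by (simp only: add.commute)
qed

lemma geometric_growth_reflect:
  assumes "geometric_growth T c" and "T \<ge> 1" and "\<epsilon> = 0 \<or> \<epsilon> = 1"
  shows "geometric_growth T (\<lambda>n. c (- n - \<epsilon>))"
proof -
  obtain M where M: "\<And>n. cmod (c n) \<le> M * T ^ nat \<bar>n\<bar>" using assms(1) by (auto simp: geometric_growth_def)
  have M0: "M \<ge> 0" using M[of 0] norm_ge_zero[of "c 0"] by (simp del: norm_ge_zero)
  have "cmod (c (- n - \<epsilon>)) \<le> (M * T) * T ^ nat \<bar>n\<bar>" for n
  proof -
    have "cmod (c (- n - \<epsilon>)) \<le> M * T ^ nat \<bar>- n - \<epsilon>\<bar>" by (rule M)
    also have "\<dots> \<le> M * T ^ Suc (nat \<bar>n\<bar>)"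
      using assms M0 by (intro mult_left_mono power_increasing) auto
    finally show ?thesis by simp
  qed
  then show ?thesis by (auto simp: geometric_growth_def)
qed

lemma hill_solution_parity:
  assumes \<epsilon>: "\<epsilon> = 0 \<or> \<epsilon> = 1" and c: "jacobi_solution (hill_diag \<epsilon>) q \<mu> c" and q: "q \<noteq> 0"
    and g: "geometric_growth T c" "T \<ge> 1" and nz: "c m \<noteq> 0"
  shows "\<exists>\<sigma>. (\<sigma> = 1 \<or> \<sigma> = -1) \<and> (\<forall>n. c (- n - \<epsilon>) = \<sigma> * c n)"
proof -
  have d: "\<And>r. r > 0 \<Longrightarrow> geometric_growth r c"
    by (rule jacobi_solution_decay[OF diag_unbounded_hill[OF \<epsilon>] c g])
  obtain \<sigma> where \<sigma>: "\<And>n. c (- n - \<epsilon>) = \<sigma> * c n"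
    using jacobi_solution_proportional[OF c jacobi_solution_reflect[OF c] q d geometric_growth_reflect[OF g \<epsilon>] g(2) nz] by blast
  have "c m = \<sigma> * (\<sigma> * c m)" using \<sigma>[of "- m - \<epsilon>"] \<sigma>[of m] by simp
  then have "\<sigma> * \<sigma> = 1" using nz by simp
  then have "\<sigma> = 1 \<or> \<sigma> = -1" by algebra
  with \<sigma> show ?thesis by blast
qed

text \<open>The Casoratian of an eigenfunction and an associated function telescopes the squares of the
  Fourier coefficients, so the bilinear square of the eigenfunction vanishes.\<close>

lemma associated_imp_isotropic:
  assumes \<epsilon>: "\<epsilon> = 0 \<or> \<epsilon> = 1" and c: "jacobi_solution (hill_diag \<epsilon>) q \<mu> c"
    and d: "\<And>r. r > 0 \<Longrightarrow> geometric_growth r c" and v: "geometric_growth T v" "T \<ge> 1"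
    and cv: "\<And>n. (\<mu> - hill_diag \<epsilon> n) * v n + s * c n = q * (v (n + 1) + v (n - 1))" and s: "s \<noteq> 0"
    and \<sigma>: "\<sigma> = 1 \<or> \<sigma> = -1" "\<And>n. c (- n - \<epsilon>) = \<sigma> * c n"
  shows "summable (\<lambda>n. (cmod (c (int n)))\<^sup>2)"
    and "(\<Sum>n. (c (int n))\<^sup>2) + (\<Sum>n. (c (int n + 1 - \<epsilon>))\<^sup>2) = 0"
proof -
  obtain C where C: "\<And>n. cmod (c n) \<le> C * (1/2) ^ nat \<bar>n\<bar>"
    using d[of "1/2"] by (auto simp: geometric_growth_def)
  show sm: "summable (\<lambda>n. (cmod (c (int n)))\<^sup>2)"
  proof (rule summable_comparison_test'[of "\<lambda>n. C\<^sup>2 * (1/4) ^ n"])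
    show "summable (\<lambda>n. C\<^sup>2 * (1/4::real) ^ n)" by (intro summable_mult summable_geometric) simp
    show "norm ((cmod (c (int n)))\<^sup>2) \<le> C\<^sup>2 * (1/4) ^ n" for n
      using power_mono[OF C[of "int n"] norm_ge_zero, of 2]
      by (simp add: power_mult_distrib power_mult[symmetric] power2_eq_square[of "1/2::real"] mult.commute[of n] power_mult[of _ 2])
  qed
  have s0: "summable (\<lambda>n. (c (int n))\<^sup>2)"
    by (rule summable_norm_cancel) (use sm in \<open>simp add: norm_power\<close>)
  have s1: "summable (\<lambda>n. (c (int n + 1 - \<epsilon>))\<^sup>2)"
    using \<epsilon> s0 summable_Suc_iff[of "\<lambda>n. (c (int n))\<^sup>2"] by (auto simp: add.commute)
  \<comment> \<open>Reflection carries -1, -2, ... to \<open>1 - \<epsilon>\<close>,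
    \<open>2 - \<epsilon>\<close>, ..., and the sign \<open>\<sigma>\<close> disappears on squaring.
    For \<open>\<epsilon> = 0\<close> the self-reflected index 0 is thus counted once.\<close>
  have reflected: "(\<Sum>n<N. (c (int n + (- int N)))\<^sup>2) = (\<Sum>n<N. (c (int n + 1 - \<epsilon>))\<^sup>2)" for N
  proof -
    have "(c (int n + (- int N)))\<^sup>2 = (c (int (N - Suc n) + 1 - \<epsilon>))\<^sup>2" if "n < N" for n
    proof -
      have "int n + (- int N) = - (int (N - Suc n) + 1 - \<epsilon>) - \<epsilon>" using that by simp
      then have "c (int n + (- int N)) = \<sigma> * c (int (N - Suc n) + 1 - \<epsilon>)" by (simp only: \<sigma>(2))
      moreover have "\<sigma>\<^sup>2 = 1" using \<sigma>(1) by auto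
      ultimately show ?thesis by (simp only: power_mult_distrib mult_1)
    qed
    then show ?thesis by (subst sum.nat_diff_reindex[symmetric]) simp
  qed
  \<comment> \<open>The sums over \<open>-N..-1\<close> and \<open>0..N-1\<close> share the
    Casoratian at -1, which cancels and leaves the two far ends.\<close>
  have eq: "s * ((\<Sum>n<N. (c (int n))\<^sup>2) + (\<Sum>n<N. (c (int n + 1 - \<epsilon>))\<^sup>2)) =
      q * (casoratian c v (int N + (-1)) - casoratian c v (- int N + (-1)))" for N
  proof -
    have e: "int N - 1 = int N + (-1)" "0 - 1 = (-1::int)" "int N + - int N - 1 = (-1)"
      "- int N - 1 = - int N + (-1)" by simp_all
    show ?thesis
      using casoratian_sum[OF c cv, where N = N and k = 0, unfolded add_0_right e]
        casoratian_sum[OF c cv, where N = N and k = "- int N", unfolded e reflected]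
      by algebra
  qed
  have "(\<lambda>N. q * (casoratian c v (int N + (-1)) - casoratian c v (- int N + (-1)))) \<longlonglongrightarrow> q * (0 - 0)"
    by (intro tendsto_intros casoratian_tendsto_0[OF d v])
  then have "(\<lambda>N. s * ((\<Sum>n<N. (c (int n))\<^sup>2) + (\<Sum>n<N. (c (int n + 1 - \<epsilon>))\<^sup>2))) \<longlonglongrightarrow> 0"
    unfolding eq by simp
  moreover have "(\<lambda>N. s * ((\<Sum>n<N. (c (int n))\<^sup>2) + (\<Sum>n<N. (c (int n + 1 - \<epsilon>))\<^sup>2))) \<longlonglongrightarrow>
      s * ((\<Sum>n. (c (int n))\<^sup>2) + (\<Sum>n. (c (int n + 1 - \<epsilon>))\<^sup>2))"
    by (intro tendsto_intros summable_LIMSEQ s0 s1)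
  ultimately have "s * ((\<Sum>n. (c (int n))\<^sup>2) + (\<Sum>n. (c (int n + 1 - \<epsilon>))\<^sup>2)) = 0"
    using LIMSEQ_unique by blast
  then show "(\<Sum>n. (c (int n))\<^sup>2) + (\<Sum>n. (c (int n + 1 - \<epsilon>))\<^sup>2) = 0" using s by simp
qed

text \<open>Index -1 is the reflection of 0, so \<open>c (-1) = \<sigma> * c 0\<close> closes row 0
  on the half-line. Both halves of the bilinear square are the same series, hence the single series
  in \<open>iso\<close>.\<close>

lemma antiperiodic_isotropic_zero:
  assumes c: "jacobi_solution (hill_diag 1) q \<mu> c" and q: "q \<noteq> 0" "(cmod q)\<^sup>2 \<le> 32/3"
    and \<sigma>: "\<sigma> = 1 \<or> \<sigma> = -1" "\<And>n. c (- n - 1) = \<sigma> * c n"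
    and sm: "summable (\<lambda>n. (cmod (c (int n)))\<^sup>2)" and iso: "(\<Sum>n. (c (int n))\<^sup>2) = 0"
  shows "c n = 0"
proof -
  have rec: "(\<mu> - hill_diag 1 n) * c n = q * (c (n + 1) + c (n - 1))" for n
    using c by (auto simp: jacobi_solution_def)
  have "c (int k) = 0" for k
  proof (rule antiperiodic_half_line[OF q \<sigma>(1) _ _ sm iso])
    show "(\<mu> - 1) * c (int 0) = q * (\<sigma> * c (int 0) + c (int 1))"
      using rec[of 0] \<sigma>(2)[of 0] by (simp add: hill_diag_def ac_simps)
    show "(\<mu> - of_real ((2 * real k + 3)\<^sup>2)) * c (int (k + 1)) = q * (c (int k) + c (int (k + 2)))" for k
      using rec[of "int k + 1"] by (simp add: hill_diag_def algebra_simps)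
  qed
  from this[of 0] this[of 1] have "c 0 = 0" "c 1 = 0" by simp_all
  then show ?thesis by (rule jacobi_solution_zero[OF c q(1)])
qed

text \<open>An even solution has row 0 \<open>\<mu> * c 0 = 2 * q * c 1\<close>, an odd one
  \<open>c 0 = 0\<close>. Dividing \<open>c 0\<close> by \<open>sqrt 2\<close> makes the folded
  matrix symmetric and the sum of squares of \<open>x\<close> exactly half the bilinear square of
  \<open>c\<close>.\<close>

lemma periodic_isotropic_zero:
  assumes c: "jacobi_solution (hill_diag 0) q \<mu> c" and q: "q \<noteq> 0" "(cmod q)\<^sup>2 \<le> 16/9"
    and \<sigma>: "\<sigma> = 1 \<or> \<sigma> = -1" "\<And>n. c (- n) = \<sigma> * c n"
    and sm: "summable (\<lambda>n. (cmod (c (int n)))\<^sup>2)"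
    and iso: "(\<Sum>n. (c (int n))\<^sup>2) + (\<Sum>n. (c (int n + 1))\<^sup>2) = 0"
  shows "c n = 0"
proof -
  have rec: "(\<mu> - hill_diag 0 n) * c n = q * (c (n + 1) + c (n - 1))" for n
    using c by (auto simp: jacobi_solution_def)
  \<comment> \<open>the weight at 0 compensates for 0 being its own reflection\<close>
  define x where "x k = (if k = 0 then c 0 / of_real (sqrt 2) else c (int k))" for k :: nat
  have x0: "c 0 = of_real (sqrt 2) * x 0" by (simp add: x_def)
  have sqrt2: "complex_of_real (sqrt 2) * (complex_of_real (sqrt 2) * z) = 2 * z" for z
    by (simp flip: mult.assoc of_real_mult)
  have xk: "x (Suc k) = c (int (Suc k))" for k by (simp add: x_def)
  have sx: "summable (\<lambda>k. (cmod (x k))\<^sup>2)"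
    using sm unfolding summable_Suc_iff[symmetric, of "\<lambda>n. (cmod (c (int n)))\<^sup>2"]
      summable_Suc_iff[symmetric, of "\<lambda>n. (cmod (x n))\<^sup>2"] xk .
  have sc: "summable (\<lambda>n. (c (int n))\<^sup>2)"
    by (rule summable_norm_cancel) (use sm in \<open>simp add: norm_power\<close>)
  have sx': "summable (\<lambda>n. (x n)\<^sup>2)"
    by (rule summable_norm_cancel) (use sx in \<open>simp add: norm_power\<close>)
  have "(\<Sum>n. (x n)\<^sup>2) = 0"
  proof -
    have "(\<Sum>n. (x n)\<^sup>2) = (\<Sum>n. (c (int (Suc n)))\<^sup>2) + (x 0)\<^sup>2"
      using suminf_split_head[OF sx'] by (simp add: xk)
    moreover have "(\<Sum>n. (c (int n))\<^sup>2) = (\<Sum>n. (c (int (Suc n)))\<^sup>2) + (c 0)\<^sup>2"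
      using suminf_split_head[OF sc] by simp
    moreover have "(c 0)\<^sup>2 = 2 * (x 0)\<^sup>2"
      by (simp add: x0 power_mult_distrib flip: of_real_power)
    ultimately have "2 * (\<Sum>n. (x n)\<^sup>2) = (\<Sum>n. (c (int n))\<^sup>2) + (\<Sum>n. (c (int (Suc n)))\<^sup>2)"
      by simp
    then show ?thesis using iso by (simp add: add.commute)
  qed
  have "x k = 0" for k
  proof (rule periodic_half_line[OF q _ _ _ sx \<open>(\<Sum>n. (x n)\<^sup>2) = 0\<close>])
    show "\<mu> * x 0 = of_real (sqrt 2) * q * x 1 \<or> x 0 = 0"
      using \<sigma>(1)
    proof
      assume "\<sigma> = 1"
      then have "\<mu> * c 0 = 2 * q * c 1" using rec[of 0] \<sigma>(2)[of 1] by (simp add: hill_diag_def)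
      then have "of_real (sqrt 2) * (\<mu> * x 0) = of_real (sqrt 2) * (of_real (sqrt 2) * q * x 1)"
        using sqrt2[of "q * x 1"] xk[of 0] by (simp add: x0 ac_simps)
      then show ?thesis by simp
    next
      assume "\<sigma> = -1"
      then have "c 0 = - c 0" using \<sigma>(2)[of 0] by simp
      then show ?thesis by (simp add: x_def)
    qed
    show "(\<mu> - 4) * x 1 = q * (of_real (sqrt 2) * x 0 + x 2)"
      using rec[of 1] by (simp add: hill_diag_def x0[symmetric]) (simp add: x_def add.commute)
    show "(\<mu> - of_real (4 * (real k + 2)\<^sup>2)) * x (k + 2) = q * (x (k + 1) + x (k + 3))" for k
      using rec[of "int k + 2"] by (simp add: hill_diag_def x_def power2_eq_square algebra_simps)
  qed
  from this[of 0] this[of 1] have "c 0 = 0" "c 1 = 0" by (simp_all add: x_def)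
  then show ?thesis by (rule jacobi_solution_zero[OF c q(1)])
qed

section \<open>Simplicity of the eigenvalues\<close>

text \<open>The factor \<open>t powi n\<close> with \<open>t\<^sup>2 = a / b\<close> makes the recurrence symmetric.\<close>

definition hill_coeff :: "complex \<Rightarrow> int \<Rightarrow> l2 \<Rightarrow> int \<Rightarrow> complex" where
  "hill_coeff t \<epsilon> u n = t powi n * fourier (2 * n + \<epsilon>) u"

lemma hill_coeff_add: "hill_coeff t \<epsilon> (u + v) n = hill_coeff t \<epsilon> u n + hill_coeff t \<epsilon> v n"
  by (simp add: hill_coeff_def fourier_add distrib_left)

lemma hill_coeff_scale: "hill_coeff t \<epsilon> (scale_l2 c u) n = c * hill_coeff t \<epsilon> u n"
  by (simp add: hill_coeff_def fourier_scale)

text \<open>Fourier coefficients are bounded; powers of \<open>t\<close> grow on one side and powers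
  of \<open>1 / t\<close> on the other, hence the maximum.\<close>

lemma hill_coeff_growth: "geometric_growth (max (cmod t) (1 / cmod t)) (hill_coeff t \<epsilon> u)"
proof -
  define T where "T = max (cmod t) (1 / cmod t)"
  obtain M where M: "\<And>k. cmod (fourier k u) \<le> M" using fourier_bounded by blast
  have t: "cmod (t powi n) \<le> T ^ nat \<bar>n\<bar>" for n
  proof (cases "n \<ge> 0")
    case True
    then show ?thesis by (auto simp: power_int_def norm_power T_def intro!: power_mono)
  next
    case False
    then have "cmod (t powi n) = (1 / cmod t) ^ nat \<bar>n\<bar>"
      by (simp add: power_int_def norm_power norm_inverse norm_divide inverse_eq_divide power_divide)
    also have "\<dots> \<le> T ^ nat \<bar>n\<bar>" by (intro power_mono) (auto simp: T_def)
    finally show ?thesis .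
  qed
  have T0: "0 \<le> T" by (simp add: T_def max.coboundedI1)
  have "cmod (hill_coeff t \<epsilon> u n) \<le> M * T ^ nat \<bar>n\<bar>" for n
  proof -
    have "cmod (hill_coeff t \<epsilon> u n) \<le> T ^ nat \<bar>n\<bar> * M"
      unfolding hill_coeff_def norm_mult using t M T0 by (intro mult_mono) auto
    then show ?thesis by (simp add: mult.commute)
  qed
  then show ?thesis by (auto simp: geometric_growth_def T_def)
qed

text \<open>Since \<open>a = b * t * t\<close>, the rescaling turns the off-diagonal entries
  \<open>a\<close> and \<open>b\<close> both into \<open>b * t\<close>, whose square is
  \<open>a * b\<close>.\<close>

lemma hill_op_coeff:
  assumes uv: "(u, v) \<in> hill_op \<theta> a b" and \<epsilon>: "wave \<epsilon> pi * \<theta> = 1" and b: "b \<noteq> 0"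
    and t: "t \<noteq> 0" and ta: "t * t = a / b"
  shows "hill_coeff t \<epsilon> v n = hill_diag \<epsilon> n * hill_coeff t \<epsilon> u n +
    (b * t) * (hill_coeff t \<epsilon> u (n + 1) + hill_coeff t \<epsilon> u (n - 1))"
proof -
  have a: "a = b * t * t" using ta b by (simp add: field_simps)
  have w: "wave (2 * n + \<epsilon>) pi * \<theta> = 1" using \<epsilon> by (simp add: wave_add wave_pi)
  have p: "t powi (n + 1) = t powi n * t" "t powi n = t powi (n - 1) * t"
    using power_int_add_1[of t n] power_int_add_1[of t "n - 1"] t by auto
  have k: "2 * n + \<epsilon> + 2 = 2 * (n + 1) + \<epsilon>" "2 * n + \<epsilon> - 2 = 2 * (n - 1) + \<epsilon>" by simp_all
  have "fourier (2 * n + \<epsilon>) v = hill_diag \<epsilon> n * fourier (2 * n + \<epsilon>) u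
      + a * fourier (2 * (n + 1) + \<epsilon>) u + b * fourier (2 * (n - 1) + \<epsilon>) u"
    using hill_op_fourier[OF uv w] unfolding k hill_diag_def .
  then show ?thesis unfolding hill_coeff_def a p(1) using p(2) by algebra
qed

lemma abs_hill_coeff_zero:
  assumes "(u, v) \<in> hill_op \<theta> a b" and "wave \<epsilon> pi * \<theta> = 1" and "t \<noteq> 0"
    and "\<And>n. hill_coeff t \<epsilon> u n = 0"
  shows "u = 0"
  using assms by (intro hill_op_fourier_complete[OF assms(1,2)]) (auto simp: hill_coeff_def power_int_not_zero)

text \<open>It suffices that \<open>u\<close> spans the eigenspace and that no nonzero multiple of
  \<open>u\<close> is reached by the shifted operator: by induction on the order, a root vector is
  mapped into the line of \<open>u\<close>, hence to 0, and so lies in that line itself.\<close>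

lemma simple_eigenvalueI:
  assumes add_scale: "\<And>u v u' v' c. (u, v) \<in> T \<Longrightarrow> (u', v') \<in> T \<Longrightarrow> (u + scale_l2 c u', v + scale_l2 c v') \<in> T"
    and u: "(u, scale_l2 \<mu> u) \<in> T" "u \<noteq> 0"
    and geo: "\<And>w. (w, scale_l2 \<mu> w) \<in> T \<Longrightarrow> \<exists>s. w = scale_l2 s u"
    and ass: "\<And>w s. (w, scale_l2 \<mu> w + scale_l2 s u) \<in> T \<Longrightarrow> s = 0"
  shows "simple_eigenvalue T \<mu>"
proof -
  have "\<exists>s. w = scale_l2 s u" if "(w, 0) \<in> shifted T \<mu> ^^ n" for n w
    using that
  proof (induction n arbitrary: w)
    case 0
    then show ?case by (auto intro!: exI[of _ 0])
  next
    case (Suc n)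
    then obtain z where z: "(w, z) \<in> shifted T \<mu>" "(z, 0) \<in> shifted T \<mu> ^^ n" by (meson relpow_Suc_D2)
    from Suc.IH[OF z(2)] obtain s where s: "z = scale_l2 s u" by blast
    from z(1) obtain v where v: "(w, v) \<in> T" "z = v - scale_l2 \<mu> w" by (auto simp: shifted_def)
    have v': "v = scale_l2 \<mu> w + scale_l2 s u" using v(2) s by (simp add: algebra_simps)
    have "s = 0" using ass v(1) unfolding v' by blast
    then show ?case using geo v(1) unfolding v' by simp
  qed
  moreover have "\<exists>n. (scale_l2 s u, 0) \<in> shifted T \<mu> ^^ n" for s
  proof -
    have "(u + scale_l2 (s - 1) u, scale_l2 \<mu> u + scale_l2 (s - 1) (scale_l2 \<mu> u)) \<in> T"
      by (rule add_scale[OF u(1) u(1)])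
    moreover have "u + scale_l2 (s - 1) u = scale_l2 s u" by (simp add: l2.scale_left_diff_distrib)
    moreover have "scale_l2 \<mu> u + scale_l2 (s - 1) (scale_l2 \<mu> u) = scale_l2 \<mu> (scale_l2 s u)"
      by (simp add: l2.scale_left_diff_distrib right_diff_distrib mult.commute)
    ultimately have "(scale_l2 s u, 0) \<in> shifted T \<mu>" by (force simp: shifted_def)
    then show ?thesis by (intro exI[of _ 1]) simp
  qed
  ultimately have "root_space T \<mu> = l2.span {u}"
    unfolding root_space_def l2.span_singleton image_def by blast
  then have "algebraic_multiplicity T \<mu> = 1"
    using u(2) by (simp add: algebraic_multiplicity_def l2.dim_span_eq_card_independent del: l2.dim_span)
  then show ?thesis using u by (auto simp: simple_eigenvalue_def eigenvalue_def)
qed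

text \<open>All that does not depend on the size of \<open>a * b\<close>, for both boundary
  conditions at once; the quantitative bounds enter through \<open>no_isotropic\<close>
  alone.\<close>

lemma hill_op_simple:
  assumes ab: "a * b \<noteq> 0" and \<epsilon>: "\<epsilon> = 0 \<or> \<epsilon> = 1" and \<theta>: "wave \<epsilon> pi * \<theta> = 1"
    and ev: "eigenvalue (hill_op \<theta> a b) \<mu>"
    and no_isotropic: "\<And>q c \<sigma> n. q\<^sup>2 = a * b \<Longrightarrow> jacobi_solution (hill_diag \<epsilon>) q \<mu> c \<Longrightarrow>
      \<sigma> = 1 \<or> \<sigma> = -1 \<Longrightarrow> (\<And>n. c (- n - \<epsilon>) = \<sigma> * c n) \<Longrightarrow> summable (\<lambda>n. (cmod (c (int n)))\<^sup>2) \<Longrightarrow>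
      (\<Sum>n. (c (int n))\<^sup>2) + (\<Sum>n. (c (int n + 1 - \<epsilon>))\<^sup>2) = 0 \<Longrightarrow> c n = 0"
  shows "simple_eigenvalue (hill_op \<theta> a b) \<mu>"
proof -
  obtain u where u: "u \<noteq> 0" "(u, scale_l2 \<mu> u) \<in> hill_op \<theta> a b" using ev by (auto simp: eigenvalue_def)
  have a: "a \<noteq> 0" and b: "b \<noteq> 0" using ab by auto
  define t where "t = csqrt (a / b)"
  have tt: "t * t = a / b" using power2_csqrt[of "a / b"] by (simp add: t_def power2_eq_square)
  have t: "t \<noteq> 0" using tt a b by auto
  define q where "q = b * t"
  have q: "q \<noteq> 0" and q2: "q\<^sup>2 = a * b" using t b tt by (auto simp: q_def power2_eq_square field_simps)
  define T where "T = max (cmod t) (1 / cmod t)"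
  have T: "T \<ge> 1" using t by (cases "cmod t \<ge> 1") (auto simp: T_def le_max_iff_disj field_simps)
  have growth: "geometric_growth T (hill_coeff t \<epsilon> w)" for w unfolding T_def by (rule hill_coeff_growth)
  note coeff = hill_op_coeff[OF _ \<theta> b t tt, folded q_def]
  have sol: "jacobi_solution (hill_diag \<epsilon>) q \<mu> (hill_coeff t \<epsilon> w)" if "(w, scale_l2 \<mu> w) \<in> hill_op \<theta> a b" for w
    unfolding jacobi_solution_def using coeff[OF that] by (simp add: hill_coeff_scale algebra_simps)
  define c where "c = hill_coeff t \<epsilon> u"
  have c: "jacobi_solution (hill_diag \<epsilon>) q \<mu> c" unfolding c_def by (rule sol[OF u(2)])
  have d: "\<And>r. r > 0 \<Longrightarrow> geometric_growth r c"
    by (rule jacobi_solution_decay[OF diag_unbounded_hill[OF \<epsilon>] c growth[of u, folded c_def] T])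
  obtain m where m: "c m \<noteq> 0" using abs_hill_coeff_zero[OF u(2) \<theta> t] u(1) unfolding c_def by blast
  show ?thesis
  proof (rule simple_eigenvalueI[OF hill_op_add_scale u(2) u(1)])
    fix w assume w: "(w, scale_l2 \<mu> w) \<in> hill_op \<theta> a b"
    obtain s where s: "\<And>n. hill_coeff t \<epsilon> w n = s * c n"
      using jacobi_solution_proportional[OF c sol[OF w] q d growth T m] by blast
    have "w + scale_l2 (- s) u = 0"
      by (rule abs_hill_coeff_zero[OF hill_op_add_scale[OF w u(2)] \<theta> t])
        (simp add: hill_coeff_add hill_coeff_scale s c_def del: l2.scale_minus_left)
    then show "\<exists>s. w = scale_l2 s u" by auto
  next
    fix w s assume w: "(w, scale_l2 \<mu> w + scale_l2 s u) \<in> hill_op \<theta> a b"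
    show "s = 0"
    proof (rule ccontr)
      assume s: "s \<noteq> 0"
      have cv: "(\<mu> - hill_diag \<epsilon> n) * hill_coeff t \<epsilon> w n + s * c n =
          q * (hill_coeff t \<epsilon> w (n + 1) + hill_coeff t \<epsilon> w (n - 1))" for n
        using coeff[OF w, of n] by (simp add: hill_coeff_add hill_coeff_scale c_def algebra_simps)
      obtain \<sigma> where \<sigma>: "\<sigma> = 1 \<or> \<sigma> = -1" "\<And>n. c (- n - \<epsilon>) = \<sigma> * c n"
        using hill_solution_parity[OF \<epsilon> c q growth[of u, folded c_def] T m] by blast
      from no_isotropic[OF q2 c \<sigma> associated_imp_isotropic[OF \<epsilon> c d growth T cv s \<sigma>], of m] m
      show False by simp
    qed
  qed
qed

theorem theorem5:
  fixes a b :: complex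
  shows "(0 < cmod (a * b) \<and> cmod (a * b) \<le> 64 / 6 \<longrightarrow>
           (\<forall>\<mu>. eigenvalue (op_A a b) \<mu> \<longrightarrow> simple_eigenvalue (op_A a b) \<mu>)) \<and>
         (0 < cmod (a * b) \<and> cmod (a * b) \<le> 16 / 9 \<longrightarrow>
           (\<forall>\<mu>. eigenvalue (op_P a b) \<mu> \<longrightarrow> simple_eigenvalue (op_P a b) \<mu>))"
proof (intro conjI impI allI; elim conjE)
  fix \<mu> assume ab: "0 < cmod (a * b)" "cmod (a * b) \<le> 64 / 6" and ev: "eigenvalue (op_A a b) \<mu>"
  show "simple_eigenvalue (op_A a b) \<mu>" unfolding op_A_hill
  \<comment> \<open>\<open>wave 1 pi = -1\<close>, so the antiperiodic problem lives on the odd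
    frequencies, where the two series in \<open>iso\<close> coincide.\<close>
  proof (rule hill_op_simple[where \<epsilon> = 1])
    fix q c \<sigma> n
    assume q: "q\<^sup>2 = a * b" and c: "jacobi_solution (hill_diag 1) q \<mu> c" "\<sigma> = 1 \<or> \<sigma> = -1"
      "\<And>n. c (- n - 1) = \<sigma> * c n" "summable (\<lambda>n. (cmod (c (int n)))\<^sup>2)"
      and iso: "(\<Sum>n. (c (int n))\<^sup>2) + (\<Sum>n. (c (int n + 1 - 1))\<^sup>2) = 0"
    have "q \<noteq> 0" using q ab by auto
    moreover have "(cmod q)\<^sup>2 \<le> 32 / 3" using ab unfolding norm_power[symmetric] q by simp
    moreover have "(\<Sum>n. (c (int n))\<^sup>2) = 0" using iso by simp
    ultimately show "c n = 0" using antiperiodic_isotropic_zero[OF c(1) _ _ c(2,3,4)] by blast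
  qed (use ab ev wave_pi(2)[of 0] op_A_hill in auto)
next
  fix \<mu> assume ab: "0 < cmod (a * b)" "cmod (a * b) \<le> 16 / 9" and ev: "eigenvalue (op_P a b) \<mu>"
  show "simple_eigenvalue (op_P a b) \<mu>" unfolding op_P_hill
  proof (rule hill_op_simple[where \<epsilon> = 0])
    fix q c \<sigma> n
    assume q: "q\<^sup>2 = a * b" and c: "jacobi_solution (hill_diag 0) q \<mu> c" "\<sigma> = 1 \<or> \<sigma> = -1"
      "\<And>n. c (- n - 0) = \<sigma> * c n" "summable (\<lambda>n. (cmod (c (int n)))\<^sup>2)"
      and iso: "(\<Sum>n. (c (int n))\<^sup>2) + (\<Sum>n. (c (int n + 1 - 0))\<^sup>2) = 0"
    have "q \<noteq> 0" using q ab by auto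
    moreover have "(cmod q)\<^sup>2 \<le> 16 / 9" using ab unfolding norm_power[symmetric] q by simp
    ultimately show "c n = 0"
      using periodic_isotropic_zero[OF c(1) _ _ c(2) c(3)[unfolded diff_0_right] c(4) iso[unfolded diff_0_right]] by blast
  qed (use ab ev op_P_hill in auto)
qed

end
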